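(* Let $A\,|\,B$ be a ring extension with centralizer $R=C_A(B)$, let $\hat{A}=\mathrm{Hom}({}_BA_B,{}_BB_B)$ and $\mathcal{C}=(A\otimes_B A)^A$, and let $\Psi:\hat{A}\otimes_R\mathcal{C}\to R$, $\Psi(F\otimes e)=e^1F(e^2)$, and $\Phi:\mathcal{C}\otimes_R\hat{A}\to R$, $\Phi(e\otimes F)=F(e^1)e^2$. Then the datum $(R,R,\hat{A},\mathcal{C},\Phi,\Psi)$ is a Morita context. Moreover $\Phi$ and $\Psi$ are surjective if any one of the following conditions is satisfied: (1) $A\,|\,B$ is a Frobenius extension; (2) $R$ is a simple ring and either $\Phi\neq 0$ or $\Psi\neq 0$; (3) one of $\hat{A}$ and $\mathcal{C}$ is an $R$-progenerator while the other is isomorphic to its corresponding $R$-dual, with $\Psi$ and $\Phi$ corresponding to evaluation and coevaluation.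
   Context: Rings are associative and unital. A ring extension $A\,|\,B$ is a unital ring homomorphism $B\to A$, making $A$ a $B$-bimodule. The centralizer is $R=C_A(B)=\{a\in A: ba=ab\ \forall b\in B\}$. $\hat{A}$ is the group of $B$-$B$-bimodule homomorphisms $A\to B$, an $R$-$R$-bimodule via $(r\cdot F\cdot r')(a)=F(r'ar)$. $\mathcal{C}=(A\otimes_B A)^A=\{e\in A\otimes_B A: ae=ea\ \forall a\in A\}$, with elements written $e=e^1\otimes e^2$ (possible summation suppressed), is an $R$-$R$-bimodule via $r\cdot e\cdot r'=e^1r'\otimes re^2$. Elements of $B$ act on $A$ via $B\to A$. The maps $\Psi$ and $\Phi$ are well-defined $R$-$R$-bimodule homomorphisms. That the datum is a Morita context means that the associativity conditions $e\cdot\Psi(F\otimes f)=\Phi(e\otimes F)\cdot f$ and $E\cdot\Phi(e\otimes F)=\Psi(E\otimes e)\cdot F$ hold for all $e,f\in\mathcal{C}$ and $E,F\in\hat{A}$. The extension $A\,|\,B$ is Frobenius if $A_B$ is finitely generated projective and ${}_BA_A\cong{}_B\mathrm{Hom}(A_B,B_B)_A$ as $B$-$A$-bimodules, where $(b\cdot f\cdot a)(x)=bf(ax)$. In (3), the reference is to Morita's theorem: for a progenerator $P_R$ with dual $P^*=\mathrm{Hom}(P_R,R_R)$, the evaluation map $P^*\otimes_{\mathrm{End}P_R}P\to R$, $f\otimes p\mapsto f(p)$, and the coevaluation map $P\otimes_R P^*\to\mathrm{End}\,P_R$, $p\otimes f\mapsto pf(-)$, are the bimodule maps of the standard Morita context;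 in (3) the endomorphism ring is identified with $R$ through the $R$-bimodule structure. *)

theory Defs
  imports "HOL-Algebra.QuotRing" "HOL-Algebra.Free_Abelian_Groups"
begin

section \<open>Modules and bimodules over noncommutative rings\<close>

text \<open>
  The underlying abelian group of a module is written multiplicatively, as a commutative group
  in the sense of HOL-Algebra: \<open>mult\<close> is the addition of the module and \<open>one\<close> its zero.
  The additive group of a ring \<open>R\<close> is \<open>add_monoid R\<close>.  Homomorphisms are extensional functions
  on the carrier of their domain, so that the sets of homomorphisms are again carriers.
\<close>

record ('l, 'r, 'm) bimod = "'m monoid" +
  lact :: "'l \<Rightarrow> 'm \<Rightarrow> 'm"
  ract :: "'m \<Rightarrow> 'r \<Rightarrow> 'm"

definition left_module :: "('l, 'x) ring_scheme \<Rightarrow> ('l, 'r, 'm, 'y) bimod_scheme \<Rightarrow> bool" where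
  "left_module R M \<longleftrightarrow> ring R \<and> comm_group M \<and>
     (\<forall>r\<in>carrier R. \<forall>m\<in>carrier M. lact M r m \<in> carrier M) \<and>
     (\<forall>r\<in>carrier R. \<forall>m\<in>carrier M. \<forall>n\<in>carrier M.
        lact M r (m \<otimes>\<^bsub>M\<^esub> n) = lact M r m \<otimes>\<^bsub>M\<^esub> lact M r n) \<and>
     (\<forall>r\<in>carrier R. \<forall>s\<in>carrier R. \<forall>m\<in>carrier M.
        lact M (r \<oplus>\<^bsub>R\<^esub> s) m = lact M r m \<otimes>\<^bsub>M\<^esub> lact M s m) \<and>
     (\<forall>r\<in>carrier R. \<forall>s\<in>carrier R. \<forall>m\<in>carrier M.
        lact M (r \<otimes>\<^bsub>R\<^esub> s) m = lact M r (lact M s m)) \<and>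
     (\<forall>m\<in>carrier M. lact M \<one>\<^bsub>R\<^esub> m = m)"

definition right_module :: "('r, 'x) ring_scheme \<Rightarrow> ('l, 'r, 'm, 'y) bimod_scheme \<Rightarrow> bool" where
  "right_module S M \<longleftrightarrow> ring S \<and> comm_group M \<and>
     (\<forall>s\<in>carrier S. \<forall>m\<in>carrier M. ract M m s \<in> carrier M) \<and>
     (\<forall>s\<in>carrier S. \<forall>m\<in>carrier M. \<forall>n\<in>carrier M.
        ract M (m \<otimes>\<^bsub>M\<^esub> n) s = ract M m s \<otimes>\<^bsub>M\<^esub> ract M n s) \<and>
     (\<forall>s\<in>carrier S. \<forall>t\<in>carrier S. \<forall>m\<in>carrier M.
        ract M m (s \<oplus>\<^bsub>S\<^esub> t) = ract M m s \<otimes>\<^bsub>M\<^esub> ract M m t) \<and>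
     (\<forall>s\<in>carrier S. \<forall>t\<in>carrier S. \<forall>m\<in>carrier M.
        ract M m (s \<otimes>\<^bsub>S\<^esub> t) = ract M (ract M m s) t) \<and>
     (\<forall>m\<in>carrier M. ract M m \<one>\<^bsub>S\<^esub> = m)"

definition bimodule ::
  "('l, 'x) ring_scheme \<Rightarrow> ('r, 'y) ring_scheme \<Rightarrow> ('l, 'r, 'm, 'z) bimod_scheme \<Rightarrow> bool" where
  "bimodule R S M \<longleftrightarrow> left_module R M \<and> right_module S M \<and>
     (\<forall>r\<in>carrier R. \<forall>s\<in>carrier S. \<forall>m\<in>carrier M.
        ract M (lact M r m) s = lact M r (ract M m s))"

definition left_hom ::
  "('l, 'x) ring_scheme \<Rightarrow> ('l, 'r, 'm, 'y) bimod_scheme \<Rightarrow> ('l, 'q, 'n, 'z) bimod_scheme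
     \<Rightarrow> ('m \<Rightarrow> 'n) set" where
  "left_hom R M N = {f \<in> hom M N \<inter> extensional (carrier M).
     \<forall>r\<in>carrier R. \<forall>m\<in>carrier M. f (lact M r m) = lact N r (f m)}"

definition right_hom ::
  "('r, 'x) ring_scheme \<Rightarrow> ('l, 'r, 'm, 'y) bimod_scheme \<Rightarrow> ('k, 'r, 'n, 'z) bimod_scheme
     \<Rightarrow> ('m \<Rightarrow> 'n) set" where
  "right_hom S M N = {f \<in> hom M N \<inter> extensional (carrier M).
     \<forall>s\<in>carrier S. \<forall>m\<in>carrier M. f (ract M m s) = ract N (f m) s}"

definition bimod_hom ::
  "('l, 'w) ring_scheme \<Rightarrow> ('r, 'x) ring_scheme
     \<Rightarrow> ('l, 'r, 'm, 'y) bimod_scheme \<Rightarrow> ('l, 'r, 'n, 'z) bimod_scheme \<Rightarrow> ('m \<Rightarrow> 'n) set" where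
  "bimod_hom R S M N = left_hom R M N \<inter> right_hom S M N"

definition bimod_iso ::
  "('l, 'w) ring_scheme \<Rightarrow> ('r, 'x) ring_scheme
     \<Rightarrow> ('l, 'r, 'm, 'y) bimod_scheme \<Rightarrow> ('l, 'r, 'n, 'z) bimod_scheme \<Rightarrow> ('m \<Rightarrow> 'n) set" where
  "bimod_iso R S M N = {f \<in> bimod_hom R S M N. bij_betw f (carrier M) (carrier N)}"

text \<open>A ring \<open>A\<close> as a bimodule by restriction along maps \<open>f\<close> and \<open>g\<close> into \<open>A\<close>.\<close>

definition ring_bimod ::
  "('a, 'x) ring_scheme \<Rightarrow> ('l \<Rightarrow> 'a) \<Rightarrow> ('r \<Rightarrow> 'a) \<Rightarrow> ('l, 'r, 'a) bimod" where
  "ring_bimod A f g =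
     \<lparr>carrier = carrier A, monoid.mult = add A, one = \<zero>\<^bsub>A\<^esub>,
      lact = (\<lambda>l a. f l \<otimes>\<^bsub>A\<^esub> a), ract = (\<lambda>a r. a \<otimes>\<^bsub>A\<^esub> g r)\<rparr>"

abbreviation regular_bimod :: "('a, 'x) ring_scheme \<Rightarrow> ('a, 'a, 'a) bimod" where
  "regular_bimod R \<equiv> ring_bimod R (\<lambda>r. r) (\<lambda>r. r)"

text \<open>
  The dual \<open>Hom(P\<^sub>S, S\<^sub>S)\<close> of an \<open>R\<close>-\<open>S\<close>-bimodule \<open>P\<close>: an \<open>S\<close>-\<open>R\<close>-bimodule through
  \<open>(s f r)(p) = s f(r p)\<close>.
\<close>

definition right_dual ::
  "('r, 'x) ring_scheme \<Rightarrow> ('l, 'r, 'm, 'y) bimod_scheme \<Rightarrow> ('r, 'l, 'm \<Rightarrow> 'r) bimod" where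
  "right_dual S P =
     \<lparr>carrier = right_hom S P (regular_bimod S),
      monoid.mult = (\<lambda>f g. \<lambda>p\<in>carrier P. f p \<oplus>\<^bsub>S\<^esub> g p),
      one = (\<lambda>p\<in>carrier P. \<zero>\<^bsub>S\<^esub>),
      lact = (\<lambda>s f. \<lambda>p\<in>carrier P. s \<otimes>\<^bsub>S\<^esub> f p),
      ract = (\<lambda>f r. \<lambda>p\<in>carrier P. f (lact P r p))\<rparr>"

definition right_End ::
  "('r, 'x) ring_scheme \<Rightarrow> ('l, 'r, 'm, 'y) bimod_scheme \<Rightarrow> ('m \<Rightarrow> 'm) ring" where
  "right_End S P =
     \<lparr>carrier = right_hom S P P,
      monoid.mult = compose (carrier P),
      one = (\<lambda>p\<in>carrier P. p),
      ring.zero = (\<lambda>p\<in>carrier P. \<one>\<^bsub>P\<^esub>),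
      add = (\<lambda>f g. \<lambda>p\<in>carrier P. f p \<otimes>\<^bsub>P\<^esub> g p)\<rparr>"


section \<open>Progenerators\<close>

text \<open>The direct sum of copies of \<open>M\<close> indexed by \<open>I\<close>, as functions of finite support.\<close>

definition copower ::
  "'i set \<Rightarrow> ('l, 'r, 'm, 'y) bimod_scheme \<Rightarrow> ('l, 'r, 'i \<Rightarrow> 'm) bimod" where
  "copower I M =
     \<lparr>carrier = {f \<in> I \<rightarrow>\<^sub>E carrier M. finite {i \<in> I. f i \<noteq> \<one>\<^bsub>M\<^esub>}},
      monoid.mult = (\<lambda>f g. \<lambda>i\<in>I. f i \<otimes>\<^bsub>M\<^esub> g i),
      one = (\<lambda>i\<in>I. \<one>\<^bsub>M\<^esub>),
      lact = (\<lambda>l f. \<lambda>i\<in>I. lact M l (f i)),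
      ract = (\<lambda>f r. \<lambda>i\<in>I. ract M (f i) r)\<rparr>"

text \<open>\<open>P\<close> is, up to isomorphism, a direct summand of the right module \<open>M\<close>.\<close>

definition right_summand ::
  "('r, 'x) ring_scheme \<Rightarrow> ('l, 'r, 'm, 'y) bimod_scheme \<Rightarrow> ('k, 'r, 'n, 'z) bimod_scheme
     \<Rightarrow> bool" where
  "right_summand S P M \<longleftrightarrow>
     (\<exists>i\<in>right_hom S P M. \<exists>q\<in>right_hom S M P. \<forall>p\<in>carrier P. q (i p) = p)"

definition right_fin_gen :: "('r, 'x) ring_scheme \<Rightarrow> ('l, 'r, 'm, 'y) bimod_scheme \<Rightarrow> bool" where
  "right_fin_gen S P \<longleftrightarrow> (\<exists>X. finite X \<and> X \<subseteq> carrier P \<and>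
     (\<forall>p\<in>carrier P. \<exists>c\<in>X \<rightarrow> carrier S. p = finprod P (\<lambda>x. ract P x (c x)) X))"

text \<open>
  Projective: a direct summand of a free module.  Index sets inside the type of \<open>P\<close> suffice,
  because \<open>P\<close> is a quotient of the free module on its own elements.
\<close>

definition right_projective :: "('r, 'x) ring_scheme \<Rightarrow> ('l, 'r, 'm, 'y) bimod_scheme \<Rightarrow> bool" where
  "right_projective S (P :: ('l, 'r, 'm, 'y) bimod_scheme) \<longleftrightarrow>
     (\<exists>I :: 'm set. right_summand S P (copower I (regular_bimod S)))"

text \<open>Generator: \<open>S\<^sub>S\<close> is a direct summand of a finite power of \<open>P\<close>.\<close>

definition right_generator :: "('r, 'x) ring_scheme \<Rightarrow> ('l, 'r, 'm, 'y) bimod_scheme \<Rightarrow> bool" where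
  "right_generator S P \<longleftrightarrow>
     (\<exists>n :: nat. right_summand S (regular_bimod S) (copower {..<n} P))"

definition right_progenerator :: "('r, 'x) ring_scheme \<Rightarrow> ('l, 'r, 'm, 'y) bimod_scheme \<Rightarrow> bool"
  where
  "right_progenerator S P \<longleftrightarrow> right_module S P \<and>
     right_fin_gen S P \<and> right_projective S P \<and> right_generator S P"


section \<open>Tensor products\<close>

text \<open>
  The tensor product over \<open>S\<close> of \<open>M\<close> and \<open>N\<close>: the free abelian group on the pairs, modulo the
  subgroup generated by the additivity and balancing relators.
\<close>

definition tensor_relators ::
  "('s, 'x) ring_scheme \<Rightarrow> ('l, 's, 'm, 'y) bimod_scheme \<Rightarrow> ('s, 'r, 'n, 'z) bimod_scheme
     \<Rightarrow> ('m \<times> 'n \<Rightarrow>\<^sub>0 int) set" where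
  "tensor_relators S M N =
     {frag_of (m \<otimes>\<^bsub>M\<^esub> m', n) - frag_of (m, n) - frag_of (m', n) | m m' n.
        m \<in> carrier M \<and> m' \<in> carrier M \<and> n \<in> carrier N} \<union>
     {frag_of (m, n \<otimes>\<^bsub>N\<^esub> n') - frag_of (m, n) - frag_of (m, n') | m n n'.
        m \<in> carrier M \<and> n \<in> carrier N \<and> n' \<in> carrier N} \<union>
     {frag_of (ract M m s, n) - frag_of (m, lact N s n) | m s n.
        m \<in> carrier M \<and> s \<in> carrier S \<and> n \<in> carrier N}"

definition tensor_kernel ::
  "('s, 'x) ring_scheme \<Rightarrow> ('l, 's, 'm, 'y) bimod_scheme \<Rightarrow> ('s, 'r, 'n, 'z) bimod_scheme
     \<Rightarrow> ('m \<times> 'n \<Rightarrow>\<^sub>0 int) set" where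
  "tensor_kernel S M N =
     generate (free_Abelian_group (carrier M \<times> carrier N)) (tensor_relators S M N)"

definition tensor_group ::
  "('s, 'x) ring_scheme \<Rightarrow> ('l, 's, 'm, 'y) bimod_scheme \<Rightarrow> ('s, 'r, 'n, 'z) bimod_scheme
     \<Rightarrow> ('m \<times> 'n \<Rightarrow>\<^sub>0 int) set monoid" where
  "tensor_group S M N = free_Abelian_group (carrier M \<times> carrier N) Mod tensor_kernel S M N"

definition tens ::
  "('s, 'x) ring_scheme \<Rightarrow> ('l, 's, 'm, 'y) bimod_scheme \<Rightarrow> ('s, 'r, 'n, 'z) bimod_scheme
     \<Rightarrow> 'm \<Rightarrow> 'n \<Rightarrow> ('m \<times> 'n \<Rightarrow>\<^sub>0 int) set" where
  "tens S M N m n =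
     tensor_kernel S M N #>\<^bsub>free_Abelian_group (carrier M \<times> carrier N)\<^esub> frag_of (m, n)"

text \<open>
  For a biadditive, \<open>S\<close>-balanced map \<open>\<beta>\<close> into an abelian group \<open>G\<close>, the homomorphism sending
  \<open>m \<otimes> n\<close> to \<open>\<beta> m n\<close>: the formal combination \<open>\<Sum> k\<^sub>i (m\<^sub>i, n\<^sub>i)\<close> of any representative of a class
  is evaluated to \<open>\<Sum> k\<^sub>i \<beta> m\<^sub>i n\<^sub>i\<close>.  This is the meaning of formulas with suppressed summation.
\<close>

definition tensor_lift ::
  "('s, 'x) ring_scheme \<Rightarrow> ('l, 's, 'm, 'y) bimod_scheme \<Rightarrow> ('s, 'r, 'n, 'z) bimod_scheme
     \<Rightarrow> ('g, 'w) monoid_scheme \<Rightarrow> ('m \<Rightarrow> 'n \<Rightarrow> 'g) \<Rightarrow> ('m \<times> 'n \<Rightarrow>\<^sub>0 int) set \<Rightarrow> 'g" where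
  "tensor_lift S M N G \<beta> = (\<lambda>X\<in>carrier (tensor_group S M N).
     the_elem ((\<lambda>x. finprod G (\<lambda>(m, n). \<beta> m n [^]\<^bsub>G\<^esub> Poly_Mapping.lookup x (m, n))
                  (Poly_Mapping.keys x)) ` X))"

text \<open>The endomorphism \<open>m \<otimes> n \<mapsto> f m \<otimes> g n\<close>.\<close>

definition tensor_endo ::
  "('s, 'x) ring_scheme \<Rightarrow> ('l, 's, 'm, 'y) bimod_scheme \<Rightarrow> ('s, 'r, 'n, 'z) bimod_scheme
     \<Rightarrow> ('m \<Rightarrow> 'm) \<Rightarrow> ('n \<Rightarrow> 'n) \<Rightarrow> ('m \<times> 'n \<Rightarrow>\<^sub>0 int) set \<Rightarrow> ('m \<times> 'n \<Rightarrow>\<^sub>0 int) set" where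
  "tensor_endo S M N f g =
     tensor_lift S M N (tensor_group S M N) (\<lambda>m n. tens S M N (f m) (g n))"

definition tensor ::
  "('s, 'x) ring_scheme \<Rightarrow> ('l, 's, 'm, 'y) bimod_scheme \<Rightarrow> ('s, 'r, 'n, 'z) bimod_scheme
     \<Rightarrow> ('l, 'r, ('m \<times> 'n \<Rightarrow>\<^sub>0 int) set) bimod" where
  "tensor S M N =
     \<lparr>carrier = carrier (tensor_group S M N),
      monoid.mult = monoid.mult (tensor_group S M N),
      one = \<one>\<^bsub>tensor_group S M N\<^esub>,
      lact = (\<lambda>l. tensor_endo S M N (\<lambda>m. lact M l m) (\<lambda>n. n)),
      ract = (\<lambda>X r. tensor_endo S M N (\<lambda>m. m) (\<lambda>n. ract N n r) X)\<rparr>"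


section \<open>Morita contexts\<close>

definition morita_context ::
  "('r, 'w) ring_scheme \<Rightarrow> ('s, 'x) ring_scheme
     \<Rightarrow> ('r, 's, 'p, 'y) bimod_scheme \<Rightarrow> ('s, 'r, 'q, 'z) bimod_scheme
     \<Rightarrow> (('q \<times> 'p \<Rightarrow>\<^sub>0 int) set \<Rightarrow> 's) \<Rightarrow> (('p \<times> 'q \<Rightarrow>\<^sub>0 int) set \<Rightarrow> 'r) \<Rightarrow> bool" where
  "morita_context R S P Q \<phi> \<psi> \<longleftrightarrow>
     ring R \<and> ring S \<and> bimodule R S P \<and> bimodule S R Q \<and>
     \<phi> \<in> bimod_hom S S (tensor R Q P) (regular_bimod S) \<and>
     \<psi> \<in> bimod_hom R R (tensor S P Q) (regular_bimod R) \<and>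
     (\<forall>q\<in>carrier Q. \<forall>p\<in>carrier P. \<forall>q'\<in>carrier Q.
        ract Q q (\<psi> (tens S P Q p q')) = lact Q (\<phi> (tens R Q P q p)) q') \<and>
     (\<forall>p\<in>carrier P. \<forall>q\<in>carrier Q. \<forall>p'\<in>carrier P.
        ract P p (\<phi> (tens R Q P q p')) = lact P (\<psi> (tens S P Q p q)) p')"

text \<open>
  \<open>P\<close> is a progenerator as right \<open>R\<close>-module, \<open>R\<close> is identified with \<open>End(P\<^sub>R)\<close> through its left
  action on \<open>P\<close>, and \<open>Q\<close> is isomorphic as a bimodule to \<open>P\<^sup>* = Hom(P\<^sub>R, R\<^sub>R)\<close> in such a way that
  \<open>\<epsilon>\<close> becomes the evaluation \<open>f \<otimes> p \<mapsto> f(p)\<close> and \<open>\<gamma>\<close> the coevaluation \<open>p \<otimes> f \<mapsto> p f(-)\<close>.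
\<close>

definition morita_dual_pair ::
  "('r, 'x) ring_scheme \<Rightarrow> ('r, 'r, 'p, 'y) bimod_scheme \<Rightarrow> ('r, 'r, 'q, 'z) bimod_scheme
     \<Rightarrow> (('q \<times> 'p \<Rightarrow>\<^sub>0 int) set \<Rightarrow> 'r) \<Rightarrow> (('p \<times> 'q \<Rightarrow>\<^sub>0 int) set \<Rightarrow> 'r) \<Rightarrow> bool" where
  "morita_dual_pair R P Q \<epsilon> \<gamma> \<longleftrightarrow>
     right_progenerator R P \<and>
     (\<lambda>r. \<lambda>p\<in>carrier P. lact P r p) \<in> ring_iso R (right_End R P) \<and>
     (\<exists>\<theta>\<in>bimod_iso R R Q (right_dual R P).
        (\<forall>q\<in>carrier Q. \<forall>p\<in>carrier P. \<epsilon> (tens R Q P q p) = \<theta> q p) \<and>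
        (\<forall>p\<in>carrier P. \<forall>q\<in>carrier Q.
           (\<lambda>x\<in>carrier P. lact P (\<gamma> (tens R P Q p q)) x) =
           (\<lambda>x\<in>carrier P. ract P p (\<theta> q x))))"


section \<open>Ring extensions\<close>

text \<open>In this section \<open>h : B \<rightarrow> A\<close> is the ring homomorphism defining the extension.\<close>

definition centralizer ::
  "('b, 'y) ring_scheme \<Rightarrow> ('a, 'x) ring_scheme \<Rightarrow> ('b \<Rightarrow> 'a) \<Rightarrow> ('a, 'x) ring_scheme" where
  "centralizer B A h =
     A\<lparr>carrier := {a \<in> carrier A. \<forall>b\<in>carrier B. h b \<otimes>\<^bsub>A\<^esub> a = a \<otimes>\<^bsub>A\<^esub> h b}\<rparr>"

definition frobenius_extension ::
  "('b, 'y) ring_scheme \<Rightarrow> ('a, 'x) ring_scheme \<Rightarrow> ('b \<Rightarrow> 'a) \<Rightarrow> bool" where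
  "frobenius_extension B A h \<longleftrightarrow>
     right_fin_gen B (ring_bimod A (\<lambda>a. a) h) \<and> right_projective B (ring_bimod A (\<lambda>a. a) h) \<and>
     bimod_iso B A (ring_bimod A h (\<lambda>a. a)) (right_dual B (ring_bimod A (\<lambda>a. a) h)) \<noteq> {}"

definition hat ::
  "('b, 'y) ring_scheme \<Rightarrow> ('a, 'x) ring_scheme \<Rightarrow> ('b \<Rightarrow> 'a) \<Rightarrow> ('a, 'a, 'a \<Rightarrow> 'b) bimod" where
  "hat B A h =
     \<lparr>carrier = bimod_hom B B (ring_bimod A h h) (regular_bimod B),
      monoid.mult = (\<lambda>F G. \<lambda>a\<in>carrier A. F a \<oplus>\<^bsub>B\<^esub> G a),
      one = (\<lambda>a\<in>carrier A. \<zero>\<^bsub>B\<^esub>),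
      lact = (\<lambda>r F. \<lambda>a\<in>carrier A. F (a \<otimes>\<^bsub>A\<^esub> r)),
      ract = (\<lambda>F r. \<lambda>a\<in>carrier A. F (r \<otimes>\<^bsub>A\<^esub> a))\<rparr>"

definition tensor_square ::
  "('b, 'y) ring_scheme \<Rightarrow> ('a, 'x) ring_scheme \<Rightarrow> ('b \<Rightarrow> 'a)
     \<Rightarrow> ('a, 'a, ('a \<times> 'a \<Rightarrow>\<^sub>0 int) set) bimod" where
  "tensor_square B A h = tensor B (ring_bimod A (\<lambda>a. a) h) (ring_bimod A h (\<lambda>a. a))"

text \<open>The actions of the centralizer on \<open>(A \<otimes>\<^sub>B A)\<^sup>A\<close> are the inner ones: \<open>r e r' = e\<^sup>1 r' \<otimes> r e\<^sup>2\<close>.\<close>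

definition casimir ::
  "('b, 'y) ring_scheme \<Rightarrow> ('a, 'x) ring_scheme \<Rightarrow> ('b \<Rightarrow> 'a)
     \<Rightarrow> ('a, 'a, ('a \<times> 'a \<Rightarrow>\<^sub>0 int) set) bimod" where
  "casimir B A h =
     \<lparr>carrier = {e \<in> carrier (tensor_square B A h).
        \<forall>a\<in>carrier A. lact (tensor_square B A h) a e = ract (tensor_square B A h) e a},
      monoid.mult = monoid.mult (tensor_square B A h),
      one = \<one>\<^bsub>tensor_square B A h\<^esub>,
      lact = (\<lambda>r. tensor_endo B (ring_bimod A (\<lambda>a. a) h) (ring_bimod A h (\<lambda>a. a))
                (\<lambda>x. x) (\<lambda>y. r \<otimes>\<^bsub>A\<^esub> y)),
      ract = (\<lambda>e r. tensor_endo B (ring_bimod A (\<lambda>a. a) h) (ring_bimod A h (\<lambda>a. a))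
                (\<lambda>x. x \<otimes>\<^bsub>A\<^esub> r) (\<lambda>y. y) e)\<rparr>"

definition Psi ::
  "('b, 'y) ring_scheme \<Rightarrow> ('a, 'x) ring_scheme \<Rightarrow> ('b \<Rightarrow> 'a)
     \<Rightarrow> (('a \<Rightarrow> 'b) \<times> ('a \<times> 'a \<Rightarrow>\<^sub>0 int) set \<Rightarrow>\<^sub>0 int) set \<Rightarrow> 'a" where
  "Psi B A h =
     tensor_lift (centralizer B A h) (hat B A h) (casimir B A h) (add_monoid (centralizer B A h))
       (\<lambda>F. tensor_lift B (ring_bimod A (\<lambda>a. a) h) (ring_bimod A h (\<lambda>a. a)) (add_monoid A)
          (\<lambda>x y. x \<otimes>\<^bsub>A\<^esub> h (F y)))"

definition Phi ::
  "('b, 'y) ring_scheme \<Rightarrow> ('a, 'x) ring_scheme \<Rightarrow> ('b \<Rightarrow> 'a)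
     \<Rightarrow> (('a \<times> 'a \<Rightarrow>\<^sub>0 int) set \<times> ('a \<Rightarrow> 'b) \<Rightarrow>\<^sub>0 int) set \<Rightarrow> 'a" where
  "Phi B A h =
     tensor_lift (centralizer B A h) (casimir B A h) (hat B A h) (add_monoid (centralizer B A h))
       (\<lambda>e F. tensor_lift B (ring_bimod A (\<lambda>a. a) h) (ring_bimod A h (\<lambda>a. a)) (add_monoid A)
          (\<lambda>x y. h (F x) \<otimes>\<^bsub>A\<^esub> y) e)"

definition simple_ring :: "('a, 'x) ring_scheme \<Rightarrow> bool" where
  "simple_ring R \<longleftrightarrow> ring R \<and> \<one>\<^bsub>R\<^esub> \<noteq> \<zero>\<^bsub>R\<^esub> \<and>
     (\<forall>I. ideal I R \<longrightarrow> I = {\<zero>\<^bsub>R\<^esub>} \<or> I = carrier R)"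

end

theory Submission
  imports Defs "HOL-Algebra.Subrings"
begin

text \<open>
  Two Casimir elements \<open>e\<close>, \<open>f\<close> satisfy \<open>e\<^sup>1 f\<^sup>1 \<otimes> f\<^sup>2 = f\<^sup>1 \<otimes> f\<^sup>2 e\<^sup>1\<close> and
  \<open>f\<^sup>2 e\<^sup>1 \<otimes> e\<^sup>2 = e\<^sup>1 \<otimes> e\<^sup>2 f\<^sup>2\<close>, so both sides of the associativity law on \<open>C\<close> equal
  \<open>f\<^sup>1 \<otimes> F(f\<^sup>2 e\<^sup>1) e\<^sup>2\<close>; the law on the dual side reduces to \<open>E(F(e\<^sup>1) e\<^sup>2) = F(e\<^sup>1 E(e\<^sup>2))\<close>.
  The images of \<open>\<Phi>\<close> and \<open>\<Psi>\<close> are two-sided ideals, so it suffices to reach \<open>1\<close>. A Frobenius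
  system \<open>(F, x\<^sub>j, y\<^sub>j)\<close> gives the Casimir element \<open>\<Sum> x\<^sub>j \<otimes> y\<^sub>j\<close>, on which both pairings with \<open>F\<close>
  are \<open>1\<close>. If \<open>R\<close> is simple, a nonzero pairing is onto, and by associativity the other one cannot
  vanish. For a dual pair, evaluation reaches \<open>1\<close> because the module is a generator, and
  coevaluation does because it has a finite dual basis.
\<close>

section \<open>Tensor products\<close>

text \<open>The obstacle is the suppressed summation. A Casimir element is a class that is usually
  not a pure tensor, and its summands need not be Casimir, so induction on pure tensors cannot run
  inside \<open>C\<close>. For this reason the maps \<open>psi F\<close> and \<open>phi F\<close>
  and all four actions are set up on the whole group \<open>T\<close>. There every identity is
  additive in the tensor and reduces to pure tensors; the Casimir condition enters afterwards, as
  the single equation \<open>outl a e = outr a e\<close>. The exchange laws for two Casimir elements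
  are this equation with a = e^1, taken under a second suppressed sum. No representatives are chosen
  for that second sum: it is carried by the map \<open>lam\<close>, which is additive in both of its
  tensors, so one tensor can range over \<open>T\<close> while the other keeps its Casimir
  property.\<close>

lemma comm_group_cong:
  assumes "comm_group G" "carrier H = carrier G" "monoid.mult H = monoid.mult G" "\<one>\<^bsub>H\<^esub> = \<one>\<^bsub>G\<^esub>"
  shows "comm_group H"
proof -
  interpret comm_group G by fact
  show ?thesis
    by (rule comm_groupI) (auto simp: assms(2-) m_assoc intro: m_comm l_inv_ex)
qed

text \<open>The unit hypothesis also covers an infinite \<open>I\<close>, where both products have
  the default value one. Taken with the identity map, the lemma carries a sum between two records
  with the same operations.\<close>

lemma hom_finprod:
  assumes "comm_monoid G" "comm_monoid H" "f \<in> hom G H" "f \<one>\<^bsub>G\<^esub> = \<one>\<^bsub>H\<^esub>" "g \<in> I \<rightarrow> carrier G"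
  shows "f (finprod G g I) = finprod H (\<lambda>i. f (g i)) I"
proof -
  interpret G: comm_monoid G by fact
  interpret H: comm_monoid H by fact
  show ?thesis
    using assms(5)
  proof (induction I rule: infinite_finite_induct)
    case (insert i I)
    then have g: "g i \<in> carrier G" "g \<in> I \<rightarrow> carrier G" by auto
    then have "(\<lambda>i. f (g i)) \<in> I \<rightarrow> carrier H" "f (g i) \<in> carrier H"
      using assms(3) by (auto simp: hom_def)
    then show ?case
      using insert g by (simp add: hom_mult[OF assms(3)])
  qed (simp_all add: assms(4))
qed

lemma (in comm_monoid) finprod_swap:
  assumes "\<And>i j. i \<in> I \<Longrightarrow> j \<in> J \<Longrightarrow> f i j \<in> carrier G" "finite I" "finite J"
  shows "finprod G (\<lambda>i. finprod G (\<lambda>j. f i j) J) I = finprod G (\<lambda>j. finprod G (\<lambda>i. f i j) I) J"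
  using assms(2,1)
proof (induction I)
  case (insert i I)
  have c: "(\<lambda>i. finprod G (f i) J) \<in> I \<rightarrow> carrier G" "(\<lambda>j. finprod G (\<lambda>i. f i j) I) \<in> J \<rightarrow> carrier G"
    "f i \<in> J \<rightarrow> carrier G"
    using insert by auto
  have "finprod G (\<lambda>j. finprod G (\<lambda>i. f i j) (insert i I)) J
        = finprod G (\<lambda>j. f i j \<otimes> finprod G (\<lambda>i. f i j) I) J"
    using insert by (intro finprod_cong) (auto simp: simp_implies_def)
  also have "\<dots> = finprod G (f i) J \<otimes> finprod G (\<lambda>j. finprod G (\<lambda>i. f i j) I) J"
    using c by (intro finprod_multf) auto
  finally show ?case
    using insert c by simp
qed simp

section \<open>Balanced maps and the universal property of the tensor product\<close>

definition balanced ::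
  "('s, 'x) ring_scheme \<Rightarrow> ('l, 's, 'm, 'y) bimod_scheme \<Rightarrow> ('s, 'r, 'n, 'z) bimod_scheme
     \<Rightarrow> ('g, 'w) monoid_scheme \<Rightarrow> ('m \<Rightarrow> 'n \<Rightarrow> 'g) \<Rightarrow> bool" where
  "balanced S M N G \<beta> \<longleftrightarrow>
     (\<forall>m\<in>carrier M. \<forall>n\<in>carrier N. \<beta> m n \<in> carrier G) \<and>
     (\<forall>m\<in>carrier M. \<forall>m'\<in>carrier M. \<forall>n\<in>carrier N. \<beta> (m \<otimes>\<^bsub>M\<^esub> m') n = \<beta> m n \<otimes>\<^bsub>G\<^esub> \<beta> m' n) \<and>
     (\<forall>m\<in>carrier M. \<forall>n\<in>carrier N. \<forall>n'\<in>carrier N. \<beta> m (n \<otimes>\<^bsub>N\<^esub> n') = \<beta> m n \<otimes>\<^bsub>G\<^esub> \<beta> m n') \<and>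
     (\<forall>m\<in>carrier M. \<forall>s\<in>carrier S. \<forall>n\<in>carrier N. \<beta> (ract M m s) n = \<beta> m (lact N s n))"

lemma balancedI:
  assumes "\<And>m n. m \<in> carrier M \<Longrightarrow> n \<in> carrier N \<Longrightarrow> \<beta> m n \<in> carrier G"
    and "\<And>m m' n. m \<in> carrier M \<Longrightarrow> m' \<in> carrier M \<Longrightarrow> n \<in> carrier N \<Longrightarrow>
           \<beta> (m \<otimes>\<^bsub>M\<^esub> m') n = \<beta> m n \<otimes>\<^bsub>G\<^esub> \<beta> m' n"
    and "\<And>m n n'. m \<in> carrier M \<Longrightarrow> n \<in> carrier N \<Longrightarrow> n' \<in> carrier N \<Longrightarrow>
           \<beta> m (n \<otimes>\<^bsub>N\<^esub> n') = \<beta> m n \<otimes>\<^bsub>G\<^esub> \<beta> m n'"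
    and "\<And>m s n. m \<in> carrier M \<Longrightarrow> s \<in> carrier S \<Longrightarrow> n \<in> carrier N \<Longrightarrow>
           \<beta> (ract M m s) n = \<beta> m (lact N s n)"
  shows "balanced S M N G \<beta>"
  using assms unfolding balanced_def by blast

lemma tensor_sel [simp]:
  "carrier (tensor S M N) = carrier (tensor_group S M N)"
  "monoid.mult (tensor S M N) = monoid.mult (tensor_group S M N)"
  "\<one>\<^bsub>tensor S M N\<^esub> = \<one>\<^bsub>tensor_group S M N\<^esub>"
  by (simp_all add: tensor_def)

text \<open>The closure conditions put the balancing relators into the free group. Together with the
  two group laws they carry the generators, the induction rule and the lifts, so the same lemmas
  serve over \<open>B\<close> for \<open>T\<close> and over \<open>R\<close> for both products of
  \<open>H\<close> and \<open>C\<close>.\<close>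

locale tensor_factors =
  fixes S :: "('s, 'x) ring_scheme"
    and M :: "('l, 's, 'm, 'y) bimod_scheme"
    and N :: "('s, 'r, 'n, 'z) bimod_scheme"
  assumes M_group: "comm_group M" and N_group: "comm_group N"
    and ract_closed: "\<And>m s. m \<in> carrier M \<Longrightarrow> s \<in> carrier S \<Longrightarrow> ract M m s \<in> carrier M"
    and lact_closed: "\<And>s n. s \<in> carrier S \<Longrightarrow> n \<in> carrier N \<Longrightarrow> lact N s n \<in> carrier N"
begin

abbreviation "Fr \<equiv> free_Abelian_group (carrier M \<times> carrier N)"
abbreviation "Ker \<equiv> tensor_kernel S M N"

lemma relators_carrier: "tensor_relators S M N \<subseteq> carrier Fr"
proof -
  interpret M: comm_group M by (rule M_group)
  interpret N: comm_group N by (rule N_group)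
  interpret F: comm_group Fr by (rule abelian_free_Abelian_group)
  have diff: "a - b \<in> carrier Fr" if "a \<in> carrier Fr" "b \<in> carrier Fr" for a b
    using that by (meson Un_least carrier_free_Abelian_group_iff keys_diff order_trans)
  show ?thesis
    unfolding tensor_relators_def
    by (intro Un_least; clarify; intro diff; simp only: frag_of_in_free_Abelian_group)
      (auto simp: ract_closed lact_closed)
qed

lemma kernel_normal: "Ker \<lhd> Fr"
  unfolding tensor_kernel_def
  by (simp add: comm_group.normal_iff_subgroup[OF abelian_free_Abelian_group]
      group.generate_is_subgroup relators_carrier)

lemma coset_eqI:
  assumes "x \<in> carrier Fr" "y \<in> carrier Fr" "x - y \<in> Ker"
  shows "Ker #>\<^bsub>Fr\<^esub> x = Ker #>\<^bsub>Fr\<^esub> y"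
proof -
  interpret normal Ker Fr by (rule kernel_normal)
  have "x \<in> Ker #>\<^bsub>Fr\<^esub> y"
    unfolding r_coset_def using assms(3) by (auto intro!: bexI[of _ "x - y"])
  then show ?thesis
    using repr_independence assms subgroup_axioms by metis
qed

lemma relator_kernel: "x \<in> tensor_relators S M N \<Longrightarrow> x \<in> Ker"
  unfolding tensor_kernel_def by (rule generate.incl)

lemma tensor_group_comm: "comm_group (tensor_group S M N)"
  unfolding tensor_group_def
  using comm_group.abelian_FactGroup[OF abelian_free_Abelian_group] normal_imp_subgroup[OF kernel_normal]
  by blast

lemma tens_closed [simp]:
  "m \<in> carrier M \<Longrightarrow> n \<in> carrier N \<Longrightarrow> tens S M N m n \<in> carrier (tensor_group S M N)"
  unfolding tens_def tensor_group_def carrier_FactGroup by auto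

lemma coset_mult:
  assumes "x \<in> carrier Fr" "y \<in> carrier Fr"
  shows "(Ker #>\<^bsub>Fr\<^esub> x) \<otimes>\<^bsub>tensor_group S M N\<^esub> (Ker #>\<^bsub>Fr\<^esub> y) = Ker #>\<^bsub>Fr\<^esub> (x + y)"
  using normal.rcos_sum[OF kernel_normal assms] by (simp add: tensor_group_def)

lemma tens_add_left:
  assumes "m \<in> carrier M" "m' \<in> carrier M" "n \<in> carrier N"
  shows "tens S M N (m \<otimes>\<^bsub>M\<^esub> m') n = tens S M N m n \<otimes>\<^bsub>tensor_group S M N\<^esub> tens S M N m' n"
proof -
  interpret M: comm_group M by (rule M_group)
  interpret F: comm_group Fr by (rule abelian_free_Abelian_group)
  have c: "frag_of (m, n) \<in> carrier Fr" "frag_of (m', n) \<in> carrier Fr"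
    "frag_of (m \<otimes>\<^bsub>M\<^esub> m', n) \<in> carrier Fr"
    using assms by auto
  have "frag_of (m \<otimes>\<^bsub>M\<^esub> m', n) - (frag_of (m, n) + frag_of (m', n)) \<in> Ker"
    by (rule relator_kernel) (use assms in \<open>auto simp: tensor_relators_def diff_diff_eq\<close>)
  moreover have "frag_of (m, n) + frag_of (m', n) \<in> carrier Fr"
    using F.m_closed[OF c(1,2)] by simp
  ultimately show ?thesis
    unfolding tens_def coset_mult[OF c(1,2)] using c(3) by (rule_tac coset_eqI)
qed

lemma tens_add_right:
  assumes "m \<in> carrier M" "n \<in> carrier N" "n' \<in> carrier N"
  shows "tens S M N m (n \<otimes>\<^bsub>N\<^esub> n') = tens S M N m n \<otimes>\<^bsub>tensor_group S M N\<^esub> tens S M N m n'"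
proof -
  interpret N: comm_group N by (rule N_group)
  interpret F: comm_group Fr by (rule abelian_free_Abelian_group)
  have c: "frag_of (m, n) \<in> carrier Fr" "frag_of (m, n') \<in> carrier Fr"
    "frag_of (m, n \<otimes>\<^bsub>N\<^esub> n') \<in> carrier Fr"
    using assms by auto
  have "frag_of (m, n \<otimes>\<^bsub>N\<^esub> n') - (frag_of (m, n) + frag_of (m, n')) \<in> Ker"
    by (rule relator_kernel) (use assms in \<open>auto simp: tensor_relators_def diff_diff_eq\<close>)
  moreover have "frag_of (m, n) + frag_of (m, n') \<in> carrier Fr"
    using F.m_closed[OF c(1,2)] by simp
  ultimately show ?thesis
    unfolding tens_def coset_mult[OF c(1,2)] using c(3) by (rule_tac coset_eqI)
qed

lemma tens_balance:
  assumes "m \<in> carrier M" "s \<in> carrier S" "n \<in> carrier N"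
  shows "tens S M N (ract M m s) n = tens S M N m (lact N s n)"
  unfolding tens_def
  by (rule coset_eqI, use assms in \<open>simp_all add: ract_closed lact_closed\<close>)
    (rule relator_kernel, use assms in \<open>auto simp: tensor_relators_def\<close>)

lemma tens_hom_left: "n \<in> carrier N \<Longrightarrow> (\<lambda>m. tens S M N m n) \<in> hom M (tensor_group S M N)"
  by (auto simp: hom_def tens_add_left)

lemma tens_hom_right: "m \<in> carrier M \<Longrightarrow> (\<lambda>n. tens S M N m n) \<in> hom N (tensor_group S M N)"
  by (auto simp: hom_def tens_add_right)

text \<open>A case for inverses is absorbed by the pure tensors: the inverse of m \<otimes> n is the
  pure tensor of the inverse of m with n.\<close>

lemma tensor_induct [consumes 1, case_names one tens mult]:
  assumes "X \<in> carrier (tensor_group S M N)"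
    and one: "P \<one>\<^bsub>tensor_group S M N\<^esub>"
    and tens: "\<And>m n. m \<in> carrier M \<Longrightarrow> n \<in> carrier N \<Longrightarrow> P (tens S M N m n)"
    and mult: "\<And>X Y. X \<in> carrier (tensor_group S M N) \<Longrightarrow> Y \<in> carrier (tensor_group S M N) \<Longrightarrow>
      P X \<Longrightarrow> P Y \<Longrightarrow> P (X \<otimes>\<^bsub>tensor_group S M N\<^esub> Y)"
  shows "P X"
proof -
  interpret T: comm_group "tensor_group S M N" by (rule tensor_group_comm)
  interpret M: comm_group M by (rule M_group)
  let ?c = "\<lambda>x. Ker #>\<^bsub>Fr\<^esub> x"
  have cc: "?c x \<in> carrier (tensor_group S M N)" if "x \<in> carrier Fr" for x
    using that by (auto simp: tensor_group_def carrier_FactGroup)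
  have c0: "?c 0 = \<one>\<^bsub>tensor_group S M N\<^esub>"
    using normal.axioms(2)[OF kernel_normal] normal_imp_subgroup[OF kernel_normal]
      group.coset_mult_one[of Fr Ker] subgroup.subset[of Ker Fr]
    by (simp add: tensor_group_def)
  have cneg: "?c (- x) = inv\<^bsub>tensor_group S M N\<^esub> ?c x" if "x \<in> carrier Fr" for x
    using that coset_mult[of "- x" x] cc[of x] cc[of "- x"] c0
    by (intro T.inv_equality[symmetric]) (auto simp: keys_minus)
  obtain x where x: "x \<in> carrier Fr" "X = ?c x"
    using assms(1) by (auto simp: tensor_group_def carrier_FactGroup)
  have inv_tens: "inv\<^bsub>tensor_group S M N\<^esub> tens S M N m n = tens S M N (inv\<^bsub>M\<^esub> m) n"
    if "m \<in> carrier M" "n \<in> carrier N" for m n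
    using group_hom.hom_inv[OF group_hom.intro, of M "tensor_group S M N" "\<lambda>m. tens S M N m n" m]
      tens_hom_left that T.group_axioms M.group_axioms by (simp add: group_hom_axioms_def)
  from x(1) have "Poly_Mapping.keys x \<subseteq> carrier M \<times> carrier N" by simp
  \<comment> \<open>Induction on the free group passes through differences x - y, so
    \<open>P\<close> is carried for a class together with its inverse.\<close>
  then have "P (?c x) \<and> P (inv\<^bsub>tensor_group S M N\<^esub> ?c x)"
  proof (induction x rule: free_Abelian_group_induct[consumes 1])
    case 1
    then show ?case using one by (simp add: c0)
  next
    case (2 x y)
    then have x: "x \<in> carrier Fr" and y: "y \<in> carrier Fr" "- y \<in> carrier Fr" by (auto simp: keys_minus)
    have "?c (x - y) = ?c x \<otimes>\<^bsub>tensor_group S M N\<^esub> inv\<^bsub>tensor_group S M N\<^esub> ?c y"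
      using coset_mult[OF x y(2)] cneg[OF y(1)] by simp
    then show ?case
      using 2 mult cc[OF x] cc[OF y(1)] by (auto simp: T.inv_mult)
  next
    case (3 a)
    then obtain m n where a: "a = (m, n)" "m \<in> carrier M" "n \<in> carrier N" by auto
    have "?c (frag_of a) = tens S M N m n" by (simp add: tens_def a)
    then show ?case
      using tens a by (simp add: inv_tens)
  qed
  then show ?thesis by (simp add: x)
qed

text \<open>Evaluating formal combinations is a homomorphism on the free group that kills the
  relators. It is therefore constant on each coset, which is what gives \<open>the_elem\<close> in
  the definition a meaning.\<close>

lemma tensor_lift:
  fixes G :: "('g, 'w) monoid_scheme"
  assumes "comm_group G" and \<beta>: "balanced S M N G \<beta>"
  shows tensor_lift_hom: "tensor_lift S M N G \<beta> \<in> hom (tensor_group S M N) G"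
    and tensor_lift_tens:
      "\<And>m n. m \<in> carrier M \<Longrightarrow> n \<in> carrier N \<Longrightarrow> tensor_lift S M N G \<beta> (tens S M N m n) = \<beta> m n"
proof -
  interpret G: comm_group G by fact
  interpret M: comm_group M by (rule M_group)
  interpret N: comm_group N by (rule N_group)
  interpret F: comm_group Fr by (rule abelian_free_Abelian_group)
  interpret K: normal Ker Fr by (rule kernel_normal)
  let ?T = "tensor_group S M N"
  let ?e = "\<lambda>(x :: _ \<Rightarrow>\<^sub>0 int) p. (case p of (m, n) \<Rightarrow> \<beta> m n [^]\<^bsub>G\<^esub> Poly_Mapping.lookup x (m, n))"
  define ev where "ev = (\<lambda>x. finprod G (?e x) (Poly_Mapping.keys x))"
  have \<beta>c: "\<beta> m n \<in> carrier G" if "m \<in> carrier M" "n \<in> carrier N" for m n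
    using \<beta> that by (auto simp: balanced_def)
  \<comment> \<open>The supports of x, y and x + y may differ, also through cancellation. Enlarging
    each to a common finite set only adds powers with exponent zero.\<close>
  have ev_ext: "ev x = finprod G (?e x) U"
    if "finite U" "Poly_Mapping.keys x \<subseteq> U" "U \<subseteq> carrier M \<times> carrier N" for x U
    unfolding ev_def
    by (rule G.finprod_mono_neutral_cong_left) (use that \<beta>c in \<open>auto simp: in_keys_iff\<close>)
  have ev_hom: "ev \<in> hom Fr G"
  proof (rule homI)
    fix x assume "x \<in> carrier Fr"
    then show "ev x \<in> carrier G"
      unfolding ev_def using \<beta>c by (intro G.finprod_closed) auto
  next
    fix x y assume xy: "x \<in> carrier Fr" "y \<in> carrier Fr"
    let ?U = "Poly_Mapping.keys x \<union> Poly_Mapping.keys y"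
    have U: "finite ?U" "?U \<subseteq> carrier M \<times> carrier N" using xy by auto
    have eU: "?e z \<in> ?U \<rightarrow> carrier G" for z using \<beta>c U(2) by auto
    have "ev (x + y) = finprod G (?e (x + y)) ?U"
      using U keys_add[of x y] by (intro ev_ext) auto
    also have "\<dots> = finprod G (\<lambda>p. ?e x p \<otimes>\<^bsub>G\<^esub> ?e y p) ?U"
      using U \<beta>c eU by (intro G.finprod_cong)
        (auto simp: simp_implies_def lookup_add G.int_pow_mult split: prod.splits)
    also have "\<dots> = finprod G (?e x) ?U \<otimes>\<^bsub>G\<^esub> finprod G (?e y) ?U"
      by (rule G.finprod_multf) (use eU in auto)
    also have "\<dots> = ev x \<otimes>\<^bsub>G\<^esub> ev y"
      using U ev_ext[of ?U x] ev_ext[of ?U y] by simp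
    finally show "ev (x \<otimes>\<^bsub>Fr\<^esub> y) = ev x \<otimes>\<^bsub>G\<^esub> ev y" by simp
  qed
  interpret ev: group_hom Fr G ev
    using ev_hom by unfold_locales
  have ev_of: "ev (frag_of (m, n)) = \<beta> m n" if "m \<in> carrier M" "n \<in> carrier N" for m n
    unfolding ev_def using \<beta>c[OF that]
    by simp
  have ev_diff: "ev (x - y) = ev x \<otimes>\<^bsub>G\<^esub> inv\<^bsub>G\<^esub> ev y" if "x \<in> carrier Fr" "y \<in> carrier Fr" for x y
    using ev.hom_mult[OF that(1), of "- y"] ev.hom_inv[OF that(2)] that by (simp add: keys_minus)
  have diffc: "x - y \<in> carrier Fr" if "x \<in> carrier Fr" "y \<in> carrier Fr" for x y
    using F.m_closed[OF that(1) F.inv_closed[OF that(2)]] that by simp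
  \<comment> \<open>The shape to which \<open>ev\<close> brings both additivity relators: a sum
    minus its two summands.\<close>
  have cancel: "a \<otimes>\<^bsub>G\<^esub> b \<otimes>\<^bsub>G\<^esub> inv\<^bsub>G\<^esub> a \<otimes>\<^bsub>G\<^esub> inv\<^bsub>G\<^esub> b = \<one>\<^bsub>G\<^esub>" if "a \<in> carrier G" "b \<in> carrier G" for a b
    using that G.m_comm[of a b] by (simp add: G.m_assoc)
  have "tensor_relators S M N \<subseteq> kernel Fr G ev"
  proof
    fix r assume r: "r \<in> tensor_relators S M N"
    then have "r \<in> carrier Fr" using relators_carrier by blast
    moreover from r have "ev r = \<one>\<^bsub>G\<^esub>"
    proof (unfold tensor_relators_def, elim UnE CollectE exE conjE)
      fix m m' n assume *: "r = frag_of (m \<otimes>\<^bsub>M\<^esub> m', n) - frag_of (m, n) - frag_of (m', n)"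
        "m \<in> carrier M" "m' \<in> carrier M" "n \<in> carrier N"
      then have "\<beta> (m \<otimes>\<^bsub>M\<^esub> m') n = \<beta> m n \<otimes>\<^bsub>G\<^esub> \<beta> m' n" using \<beta> by (simp add: balanced_def)
      then show ?thesis
        using * by (simp add: ev_diff diffc[simplified] ev_of \<beta>c cancel)
    next
      fix m n n' assume *: "r = frag_of (m, n \<otimes>\<^bsub>N\<^esub> n') - frag_of (m, n) - frag_of (m, n')"
        "m \<in> carrier M" "n \<in> carrier N" "n' \<in> carrier N"
      then have "\<beta> m (n \<otimes>\<^bsub>N\<^esub> n') = \<beta> m n \<otimes>\<^bsub>G\<^esub> \<beta> m n'" using \<beta> by (simp add: balanced_def)
      then show ?thesis
        using * by (simp add: ev_diff diffc[simplified] ev_of \<beta>c cancel)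
    next
      fix m s n assume *: "r = frag_of (ract M m s, n) - frag_of (m, lact N s n)"
        "m \<in> carrier M" "s \<in> carrier S" "n \<in> carrier N"
      then have "\<beta> (ract M m s) n = \<beta> m (lact N s n)" using \<beta> by (simp add: balanced_def)
      then show ?thesis
        using * by (simp add: ev_diff ev_of \<beta>c ract_closed lact_closed)
    qed
    ultimately show "r \<in> kernel Fr G ev" by (simp add: kernel_def)
  qed
  then have "Ker \<subseteq> kernel Fr G ev"
    unfolding tensor_kernel_def
    by (intro F.generate_subgroup_incl ev.subgroup_kernel)
  then have ev_ker: "k \<in> Ker \<Longrightarrow> k \<in> carrier Fr \<and> ev k = \<one>\<^bsub>G\<^esub>" for k by (auto simp: kernel_def)
  have lift_coset: "tensor_lift S M N G \<beta> (Ker #>\<^bsub>Fr\<^esub> x) = ev x" if x: "x \<in> carrier Fr" for x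
  proof -
    have "ev ` (Ker #>\<^bsub>Fr\<^esub> x) = {ev x}"
    proof (intro equalityI subsetI)
      fix y assume "y \<in> ev ` (Ker #>\<^bsub>Fr\<^esub> x)"
      then obtain k where "k \<in> Ker" "y = ev (k \<otimes>\<^bsub>Fr\<^esub> x)" by (auto simp: r_coset_def)
      then show "y \<in> {ev x}"
        using ev_ker[of k] x ev.hom_closed[OF x] by (subst (asm) ev.hom_mult) auto
    next
      fix y assume "y \<in> {ev x}"
      then show "y \<in> ev ` (Ker #>\<^bsub>Fr\<^esub> x)"
        using F.rcos_self[OF x normal_imp_subgroup[OF kernel_normal]] by auto
    qed
    moreover have "Ker #>\<^bsub>Fr\<^esub> x \<in> carrier ?T"
      using x by (auto simp: tensor_group_def carrier_FactGroup)
    ultimately show ?thesis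
      by (simp add: tensor_lift_def ev_def)
  qed
  show "tensor_lift S M N G \<beta> (tens S M N m n) = \<beta> m n" if "m \<in> carrier M" "n \<in> carrier N" for m n
    using lift_coset[of "frag_of (m, n)"] that by (simp add: tens_def ev_of)
  show "tensor_lift S M N G \<beta> \<in> hom ?T G"
  proof (rule homI)
    fix X assume "X \<in> carrier ?T"
    then obtain x where "x \<in> carrier Fr" "X = Ker #>\<^bsub>Fr\<^esub> x"
      by (auto simp: tensor_group_def carrier_FactGroup)
    then show "tensor_lift S M N G \<beta> X \<in> carrier G" using lift_coset ev.hom_closed by simp
  next
    fix X Y assume "X \<in> carrier ?T" "Y \<in> carrier ?T"
    then obtain x y where xy: "x \<in> carrier Fr" "X = Ker #>\<^bsub>Fr\<^esub> x" "y \<in> carrier Fr" "Y = Ker #>\<^bsub>Fr\<^esub> y"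
      by (auto simp: tensor_group_def carrier_FactGroup)
    then show "tensor_lift S M N G \<beta> (X \<otimes>\<^bsub>?T\<^esub> Y) = tensor_lift S M N G \<beta> X \<otimes>\<^bsub>G\<^esub> tensor_lift S M N G \<beta> Y"
      using lift_coset F.m_closed[OF xy(1,3)] ev.hom_mult[OF xy(1,3)] by (simp add: coset_mult del: carrier_free_Abelian_group_iff)
  qed
qed

lemma tensor_lift_extensional: "tensor_lift S M N G \<beta> \<in> extensional (carrier (tensor_group S M N))"
  by (simp add: tensor_lift_def)

lemma tensor_endo:
  assumes f: "f \<in> hom M M" "\<And>m s. m \<in> carrier M \<Longrightarrow> s \<in> carrier S \<Longrightarrow> f (ract M m s) = ract M (f m) s"
    and g: "g \<in> hom N N" "\<And>s n. s \<in> carrier S \<Longrightarrow> n \<in> carrier N \<Longrightarrow> g (lact N s n) = lact N s (g n)"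
  shows tensor_endo_hom: "tensor_endo S M N f g \<in> hom (tensor_group S M N) (tensor_group S M N)"
    and tensor_endo_tens: "\<And>m n. m \<in> carrier M \<Longrightarrow> n \<in> carrier N \<Longrightarrow>
      tensor_endo S M N f g (tens S M N m n) = tens S M N (f m) (g n)"
proof -
  have [simp]: "f m \<in> carrier M" if "m \<in> carrier M" for m using f that by (auto simp: hom_def)
  have [simp]: "g n \<in> carrier N" if "n \<in> carrier N" for n using g that by (auto simp: hom_def)
  have "balanced S M N (tensor_group S M N) (\<lambda>m n. tens S M N (f m) (g n))"
    by (rule balancedI)
      (simp_all add: hom_mult[OF f(1)] hom_mult[OF g(1)] tens_add_left tens_add_right f(2) g(2) tens_balance)
  then show "tensor_endo S M N f g \<in> hom (tensor_group S M N) (tensor_group S M N)"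
    "\<And>m n. m \<in> carrier M \<Longrightarrow> n \<in> carrier N \<Longrightarrow>
      tensor_endo S M N f g (tens S M N m n) = tens S M N (f m) (g n)"
    unfolding tensor_endo_def using tensor_lift[OF tensor_group_comm] by blast+
qed

end

lemma id_hom: "(\<lambda>x. x) \<in> hom G G"
  by (simp add: hom_def)

section \<open>Module actions on tensor products and linear lifts\<close>

lemma tensor_factors_modules:
  "right_module S M \<Longrightarrow> left_module S N \<Longrightarrow> tensor_factors S M N"
  by (simp add: tensor_factors_def right_module_def left_module_def)

lemma
  assumes M: "bimodule R S M" and N: "left_module S N" and r: "r \<in> carrier R"
  shows tensor_lact_hom: "lact (tensor S M N) r \<in> hom (tensor_group S M N) (tensor_group S M N)"
    and tensor_lact_tens: "\<And>m n. m \<in> carrier M \<Longrightarrow> n \<in> carrier N \<Longrightarrow>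
      lact (tensor S M N) r (tens S M N m n) = tens S M N (lact M r m) n"
proof -
  interpret tensor_factors S M N
    using assms by (simp add: tensor_factors_modules bimodule_def)
  have "lact M r \<in> hom M M"
    using assms by (auto simp: hom_def bimodule_def left_module_def)
  then show "lact (tensor S M N) r \<in> hom (tensor_group S M N) (tensor_group S M N)"
    "\<And>m n. m \<in> carrier M \<Longrightarrow> n \<in> carrier N \<Longrightarrow>
      lact (tensor S M N) r (tens S M N m n) = tens S M N (lact M r m) n"
    using M r unfolding bimodule_def
    by (simp_all add: tensor_def tensor_endo_hom tensor_endo_tens id_hom)
qed

lemma
  assumes M: "right_module S M" and N: "bimodule S R N" and r: "r \<in> carrier R"
  shows tensor_ract_hom: "(\<lambda>X. ract (tensor S M N) X r) \<in> hom (tensor_group S M N) (tensor_group S M N)"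
    and tensor_ract_tens: "\<And>m n. m \<in> carrier M \<Longrightarrow> n \<in> carrier N \<Longrightarrow>
      ract (tensor S M N) (tens S M N m n) r = tens S M N m (ract N n r)"
proof -
  interpret tensor_factors S M N
    using assms by (simp add: tensor_factors_modules bimodule_def)
  have "(\<lambda>n. ract N n r) \<in> hom N N"
    using assms by (auto simp: hom_def bimodule_def right_module_def)
  then show "(\<lambda>X. ract (tensor S M N) X r) \<in> hom (tensor_group S M N) (tensor_group S M N)"
    "\<And>m n. m \<in> carrier M \<Longrightarrow> n \<in> carrier N \<Longrightarrow>
      ract (tensor S M N) (tens S M N m n) r = tens S M N m (ract N n r)"
    using N r unfolding bimodule_def
    by (simp_all add: tensor_def tensor_endo_hom tensor_endo_tens id_hom)
qed

lemma ring_bimod_sel [simp]: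
  "carrier (ring_bimod A f g) = carrier A"
  "monoid.mult (ring_bimod A f g) = add A"
  "\<one>\<^bsub>ring_bimod A f g\<^esub> = \<zero>\<^bsub>A\<^esub>"
  "lact (ring_bimod A f g) l a = f l \<otimes>\<^bsub>A\<^esub> a"
  "ract (ring_bimod A f g) a r = a \<otimes>\<^bsub>A\<^esub> g r"
  by (simp_all add: ring_bimod_def)

text \<open>Linearity over either ring is additive in the tensor, so by \<open>tensor_induct\<close>
  it follows from the case of pure tensors, which the last two hypotheses provide.\<close>

lemma tensor_lift_bimod_hom:
  assumes M: "bimodule R S M" and N: "bimodule S Q N" and A: "ring A"
    and f: "\<And>r. r \<in> carrier R \<Longrightarrow> f r \<in> carrier A" and g: "\<And>r. r \<in> carrier Q \<Longrightarrow> g r \<in> carrier A"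
    and \<beta>: "balanced S M N (add_monoid A) \<beta>"
    and l: "\<And>r m n. r \<in> carrier R \<Longrightarrow> m \<in> carrier M \<Longrightarrow> n \<in> carrier N \<Longrightarrow>
      \<beta> (lact M r m) n = f r \<otimes>\<^bsub>A\<^esub> \<beta> m n"
    and r: "\<And>r m n. r \<in> carrier Q \<Longrightarrow> m \<in> carrier M \<Longrightarrow> n \<in> carrier N \<Longrightarrow>
      \<beta> m (ract N n r) = \<beta> m n \<otimes>\<^bsub>A\<^esub> g r"
  shows "tensor_lift S M N (add_monoid A) \<beta> \<in> bimod_hom R Q (tensor S M N) (ring_bimod A f g)"
proof -
  interpret A: ring A by fact
  interpret tensor_factors S M N
    using M N by (simp add: tensor_factors_modules bimodule_def)
  interpret T: comm_group "tensor_group S M N" by (rule tensor_group_comm)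
  have RM: "right_module S M" "left_module S N" "left_module R M" "right_module Q N"
    using M N by (simp_all add: bimodule_def)
  let ?t = "tensor_lift S M N (add_monoid A) \<beta>"
  note t = tensor_lift[OF A.a_comm_group \<beta>]
  have [simp]: "\<beta> m n \<in> carrier A" if "m \<in> carrier M" "n \<in> carrier N" for m n
    using \<beta> that by (simp add: balanced_def)
  have t1: "?t \<one>\<^bsub>tensor_group S M N\<^esub> = \<zero>\<^bsub>A\<^esub>"
    using hom_one[OF t(1) T.is_group] A.add.is_group by simp
  have tc: "X \<in> carrier (tensor_group S M N) \<Longrightarrow> ?t X \<in> carrier A" for X
    using t(1) by (auto simp: hom_def)
  have "?t (lact (tensor S M N) r X) = f r \<otimes>\<^bsub>A\<^esub> ?t X"
    if r: "r \<in> carrier R" and X: "X \<in> carrier (tensor_group S M N)" for r X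
    using X
  proof (induction X rule: tensor_induct)
    case one
    then show ?case
      using hom_one[OF tensor_lact_hom[OF M RM(2) r] T.is_group T.is_group] t1 f[OF r] by simp
  next
    case (tens m n)
    moreover have "lact M r m \<in> carrier M" using tens RM r by (simp add: left_module_def)
    ultimately show ?case
      using r by (simp add: tensor_lact_tens[OF M RM(2) r] t(2) l)
  next
    case (mult X Y)
    moreover have "lact (tensor S M N) r X \<in> carrier (tensor_group S M N)"
      "lact (tensor S M N) r Y \<in> carrier (tensor_group S M N)"
      using mult tensor_lact_hom[OF M RM(2) r] by (auto simp: hom_def)
    ultimately show ?case
      using f[OF r] by (simp add: hom_mult[OF t(1)] hom_mult[OF tensor_lact_hom[OF M RM(2) r]] A.r_distr tc)
  qed
  moreover have "?t (ract (tensor S M N) X r) = ?t X \<otimes>\<^bsub>A\<^esub> g r"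
    if r: "r \<in> carrier Q" and X: "X \<in> carrier (tensor_group S M N)" for r X
    using X
  proof (induction X rule: tensor_induct)
    case one
    then show ?case
      using hom_one[OF tensor_ract_hom[OF RM(1) N r] T.is_group T.is_group] t1 g[OF r] by simp
  next
    case (tens m n)
    moreover have "ract N n r \<in> carrier N" using tens RM r by (simp add: right_module_def)
    ultimately show ?case
      using r assms(8) by (simp add: tensor_ract_tens[OF RM(1) N r] t(2))
  next
    case (mult X Y)
    moreover have "ract (tensor S M N) X r \<in> carrier (tensor_group S M N)"
      "ract (tensor S M N) Y r \<in> carrier (tensor_group S M N)"
      using mult tensor_ract_hom[OF RM(1) N r] by (auto simp: hom_def)
    ultimately show ?case
      using g[OF r] by (simp add: hom_mult[OF t(1)] hom_mult[OF tensor_ract_hom[OF RM(1) N r]] A.l_distr tc)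
  qed
  moreover have "?t \<in> hom (tensor S M N) (ring_bimod A f g)"
    using t(1) by (simp add: hom_def)
  ultimately show ?thesis
    by (simp add: bimod_hom_def left_hom_def right_hom_def tensor_lift_extensional)
qed

section \<open>The bimodules of a ring extension\<close>

locale ring_extension =
  fixes A :: "('a, 'x) ring_scheme" and B :: "('b, 'y) ring_scheme" and h :: "'b \<Rightarrow> 'a"
  assumes extension: "ring_hom_ring B A h"
begin

sublocale A: ring A + B: ring B
  using extension by (simp_all add: ring_hom_ring_def)

sublocale h: ring_hom_ring B A h
  by (rule extension)

abbreviation "L \<equiv> ring_bimod A (\<lambda>a. a) h"
abbreviation "N \<equiv> ring_bimod A h (\<lambda>a. a)"
abbreviation "T \<equiv> tensor_group B L N"
abbreviation "R \<equiv> centralizer B A h"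
abbreviation "C \<equiv> casimir B A h"
abbreviation "H \<equiv> hat B A h"
abbreviation tns (infixl "\<otimes>\<^sub>B" 70) where "x \<otimes>\<^sub>B y \<equiv> tens B L N x y"

lemma ring_bimod_group: "comm_group (ring_bimod A f g)"
  by (rule comm_group_cong[OF A.a_comm_group]) simp_all

sublocale AA: tensor_factors B L N
  by (rule tensor_factors.intro) (simp_all add: ring_bimod_group)

sublocale T: comm_group T
  by (rule AA.tensor_group_comm)

section \<open>The centralizer as a ring\<close>

lemma centralizer_iff:
  "r \<in> carrier R \<longleftrightarrow> r \<in> carrier A \<and> (\<forall>b\<in>carrier B. h b \<otimes>\<^bsub>A\<^esub> r = r \<otimes>\<^bsub>A\<^esub> h b)"
  by (simp add: centralizer_def)

lemma centralizer_in: "r \<in> carrier R \<Longrightarrow> r \<in> carrier A"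
  by (simp add: centralizer_iff)

lemma centralizer_comm: "r \<in> carrier R \<Longrightarrow> b \<in> carrier B \<Longrightarrow> r \<otimes>\<^bsub>A\<^esub> h b = h b \<otimes>\<^bsub>A\<^esub> r"
  by (simp add: centralizer_iff)

lemma centralizer_sel [simp]:
  "monoid.mult R = monoid.mult A" "add R = add A" "\<one>\<^bsub>R\<^esub> = \<one>\<^bsub>A\<^esub>" "\<zero>\<^bsub>R\<^esub> = \<zero>\<^bsub>A\<^esub>"
  by (simp_all add: centralizer_def)

lemma centralizer_ring: "ring R"
proof -
  have "subring (carrier R) A"
  proof (rule A.subringI)
    fix r assume r: "r \<in> carrier R"
    then show "\<ominus>\<^bsub>A\<^esub> r \<in> carrier R"
      by (auto simp: centralizer_iff A.r_minus A.l_minus)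
  next
    fix r s assume rs: "r \<in> carrier R" "s \<in> carrier R"
    then show "r \<oplus>\<^bsub>A\<^esub> s \<in> carrier R"
      by (auto simp: centralizer_iff A.r_distr A.l_distr)
    have "h b \<otimes>\<^bsub>A\<^esub> (r \<otimes>\<^bsub>A\<^esub> s) = r \<otimes>\<^bsub>A\<^esub> s \<otimes>\<^bsub>A\<^esub> h b" if "b \<in> carrier B" for b
      using rs that by (simp add: A.m_assoc centralizer_comm centralizer_in)
        (simp add: A.m_assoc[symmetric] centralizer_comm centralizer_in)
    then show "r \<otimes>\<^bsub>A\<^esub> s \<in> carrier R"
      using rs by (simp add: centralizer_iff)
  qed (auto simp: centralizer_iff)
  then have "ring (A\<lparr>carrier := carrier R\<rparr>)"
    by (rule A.subring_is_ring)
  moreover have "A\<lparr>carrier := carrier R\<rparr> = R"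
    unfolding centralizer_def by simp
  ultimately show ?thesis
    by (simp only:)
qed

sublocale R: ring R
  by (rule centralizer_ring)

declare centralizer_in [simp]

section \<open>Outer and inner actions on the tensor square\<close>

definition outl :: "'a \<Rightarrow> ('a \<times> 'a \<Rightarrow>\<^sub>0 int) set \<Rightarrow> ('a \<times> 'a \<Rightarrow>\<^sub>0 int) set" where
  "outl a = tensor_endo B L N (\<lambda>x. a \<otimes>\<^bsub>A\<^esub> x) (\<lambda>y. y)"

definition outr :: "'a \<Rightarrow> ('a \<times> 'a \<Rightarrow>\<^sub>0 int) set \<Rightarrow> ('a \<times> 'a \<Rightarrow>\<^sub>0 int) set" where
  "outr a = tensor_endo B L N (\<lambda>x. x) (\<lambda>y. y \<otimes>\<^bsub>A\<^esub> a)"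

definition inl :: "'a \<Rightarrow> ('a \<times> 'a \<Rightarrow>\<^sub>0 int) set \<Rightarrow> ('a \<times> 'a \<Rightarrow>\<^sub>0 int) set" where
  "inl r = tensor_endo B L N (\<lambda>x. x) (\<lambda>y. r \<otimes>\<^bsub>A\<^esub> y)"

definition inr :: "'a \<Rightarrow> ('a \<times> 'a \<Rightarrow>\<^sub>0 int) set \<Rightarrow> ('a \<times> 'a \<Rightarrow>\<^sub>0 int) set" where
  "inr r = tensor_endo B L N (\<lambda>x. x \<otimes>\<^bsub>A\<^esub> r) (\<lambda>y. y)"

lemma mult_homs:
  assumes "a \<in> carrier A"
  shows "(\<lambda>x. a \<otimes>\<^bsub>A\<^esub> x) \<in> hom (ring_bimod A f g) (ring_bimod A f g)"
    and "(\<lambda>x. x \<otimes>\<^bsub>A\<^esub> a) \<in> hom (ring_bimod A f g) (ring_bimod A f g)"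
  using assms by (auto simp: hom_def A.r_distr A.l_distr)

lemma outl:
  assumes "a \<in> carrier A"
  shows outl_hom: "outl a \<in> hom T T"
    and outl_tens [simp]: "\<And>x y. x \<in> carrier A \<Longrightarrow> y \<in> carrier A \<Longrightarrow> outl a (x \<otimes>\<^sub>B y) = (a \<otimes>\<^bsub>A\<^esub> x) \<otimes>\<^sub>B y"
  unfolding outl_def using assms
  by - (intro AA.tensor_endo_hom AA.tensor_endo_tens mult_homs id_hom; simp add: A.m_assoc)+

lemma outr:
  assumes "a \<in> carrier A"
  shows outr_hom: "outr a \<in> hom T T"
    and outr_tens [simp]: "\<And>x y. x \<in> carrier A \<Longrightarrow> y \<in> carrier A \<Longrightarrow> outr a (x \<otimes>\<^sub>B y) = x \<otimes>\<^sub>B (y \<otimes>\<^bsub>A\<^esub> a)"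
  unfolding outr_def using assms
  by - (intro AA.tensor_endo_hom AA.tensor_endo_tens mult_homs id_hom; simp add: A.m_assoc)+

text \<open>The map y \<mapsto> r y commutes with left multiplication by every \<open>h b\<close>
  exactly when r lies in the centralizer, and \<open>tensor_endo\<close> asks for this commutation.
  For the outer actions associativity is enough, so there the multiplier ranges over all of
  \<open>A\<close>.\<close>

lemma inl:
  assumes "r \<in> carrier R"
  shows inl_hom: "inl r \<in> hom T T"
    and inl_tens [simp]: "\<And>x y. x \<in> carrier A \<Longrightarrow> y \<in> carrier A \<Longrightarrow> inl r (x \<otimes>\<^sub>B y) = x \<otimes>\<^sub>B (r \<otimes>\<^bsub>A\<^esub> y)"
  unfolding inl_def using assms
  by - (intro AA.tensor_endo_hom AA.tensor_endo_tens mult_homs id_hom; simp add: A.m_assoc[symmetric] centralizer_comm)+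

lemma inr:
  assumes "r \<in> carrier R"
  shows inr_hom: "inr r \<in> hom T T"
    and inr_tens [simp]: "\<And>x y. x \<in> carrier A \<Longrightarrow> y \<in> carrier A \<Longrightarrow> inr r (x \<otimes>\<^sub>B y) = (x \<otimes>\<^bsub>A\<^esub> r) \<otimes>\<^sub>B y"
  unfolding inr_def using assms
  by - (intro AA.tensor_endo_hom AA.tensor_endo_tens mult_homs id_hom; simp add: A.m_assoc centralizer_comm)+

lemma hom_simps:
  assumes "f \<in> hom T T"
  shows "f \<one>\<^bsub>T\<^esub> = \<one>\<^bsub>T\<^esub>" "\<And>X. X \<in> carrier T \<Longrightarrow> f X \<in> carrier T"
    "\<And>X Y. X \<in> carrier T \<Longrightarrow> Y \<in> carrier T \<Longrightarrow> f (X \<otimes>\<^bsub>T\<^esub> Y) = f X \<otimes>\<^bsub>T\<^esub> f Y"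
    "\<And>X. X \<in> carrier T \<Longrightarrow> f (inv\<^bsub>T\<^esub> X) = inv\<^bsub>T\<^esub> (f X)"
proof -
  interpret f: group_hom T T f
    using assms by unfold_locales
  show "f \<one>\<^bsub>T\<^esub> = \<one>\<^bsub>T\<^esub>" "\<And>X. X \<in> carrier T \<Longrightarrow> f X \<in> carrier T"
    "\<And>X Y. X \<in> carrier T \<Longrightarrow> Y \<in> carrier T \<Longrightarrow> f (X \<otimes>\<^bsub>T\<^esub> Y) = f X \<otimes>\<^bsub>T\<^esub> f Y"
    "\<And>X. X \<in> carrier T \<Longrightarrow> f (inv\<^bsub>T\<^esub> X) = inv\<^bsub>T\<^esub> (f X)"
    by simp_all
qed

lemmas action_simps [simp] =
  hom_simps[OF outl_hom] hom_simps[OF outr_hom] hom_simps[OF inl_hom] hom_simps[OF inr_hom]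

lemma actions_commute:
  assumes "X \<in> carrier T"
  shows "\<And>a r. a \<in> carrier A \<Longrightarrow> r \<in> carrier R \<Longrightarrow> outl a (inl r X) = inl r (outl a X)"
    "\<And>a r. a \<in> carrier A \<Longrightarrow> r \<in> carrier R \<Longrightarrow> outl a (inr r X) = inr r (outl a X)"
    "\<And>a r. a \<in> carrier A \<Longrightarrow> r \<in> carrier R \<Longrightarrow> outr a (inl r X) = inl r (outr a X)"
    "\<And>a r. a \<in> carrier A \<Longrightarrow> r \<in> carrier R \<Longrightarrow> outr a (inr r X) = inr r (outr a X)"
    "\<And>r s. r \<in> carrier R \<Longrightarrow> s \<in> carrier R \<Longrightarrow> inl r (inr s X) = inr s (inl r X)"
  using assms by (induction X rule: AA.tensor_induct) (simp_all add: A.m_assoc)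

lemma inner_one:
  assumes "X \<in> carrier T"
  shows "inl \<one>\<^bsub>A\<^esub> X = X" "inr \<one>\<^bsub>A\<^esub> X = X"
proof -
  have one: "\<one>\<^bsub>A\<^esub> \<in> carrier R" using R.one_closed by simp
  show "inl \<one>\<^bsub>A\<^esub> X = X" "inr \<one>\<^bsub>A\<^esub> X = X"
    using assms by (induction X rule: AA.tensor_induct) (simp_all add: one)
qed

lemma inner_module:
  assumes "X \<in> carrier T" "r \<in> carrier R" "s \<in> carrier R"
  shows "inl (r \<oplus>\<^bsub>A\<^esub> s) X = inl r X \<otimes>\<^bsub>T\<^esub> inl s X" "inr (r \<oplus>\<^bsub>A\<^esub> s) X = inr r X \<otimes>\<^bsub>T\<^esub> inr s X"
    "inl (r \<otimes>\<^bsub>A\<^esub> s) X = inl r (inl s X)" "inr (r \<otimes>\<^bsub>A\<^esub> s) X = inr s (inr r X)"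
proof -
  have rs: "r \<oplus>\<^bsub>A\<^esub> s \<in> carrier R" "r \<otimes>\<^bsub>A\<^esub> s \<in> carrier R"
    using assms R.a_closed[of r s] R.m_closed[of r s] by simp_all
  show "inl (r \<otimes>\<^bsub>A\<^esub> s) X = inl r (inl s X)" "inr (r \<otimes>\<^bsub>A\<^esub> s) X = inr s (inr r X)"
    using assms(1)
    by (induction X rule: AA.tensor_induct) (use assms(2-) rs in \<open>simp_all add: A.m_assoc\<close>)
  show "inl (r \<oplus>\<^bsub>A\<^esub> s) X = inl r X \<otimes>\<^bsub>T\<^esub> inl s X"
    using assms(1)
  proof (induction X rule: AA.tensor_induct)
    case (tens m n)
    then show ?case using assms(2-) rs AA.tens_add_right[of m "r \<otimes>\<^bsub>A\<^esub> n" "s \<otimes>\<^bsub>A\<^esub> n"]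
      by (simp add: A.l_distr)
  qed (use assms(2-) rs in \<open>simp_all add: T.m_ac\<close>)
  show "inr (r \<oplus>\<^bsub>A\<^esub> s) X = inr r X \<otimes>\<^bsub>T\<^esub> inr s X"
    using assms(1)
  proof (induction X rule: AA.tensor_induct)
    case (tens m n)
    then show ?case using assms(2-) rs AA.tens_add_left[of "m \<otimes>\<^bsub>A\<^esub> r" "m \<otimes>\<^bsub>A\<^esub> s" n]
      by (simp add: A.r_distr)
  qed (use assms(2-) rs in \<open>simp_all add: T.m_ac\<close>)
qed

section \<open>The Casimir elements as a bimodule\<close>

lemma casimir_sel [simp]:
  "carrier C = {e \<in> carrier T. \<forall>a\<in>carrier A. outl a e = outr a e}"
  "monoid.mult C = monoid.mult T" "\<one>\<^bsub>C\<^esub> = \<one>\<^bsub>T\<^esub>" "lact C r = inl r" "ract C e r = inr r e"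
  by (simp_all add: casimir_def tensor_square_def tensor_def outl_def outr_def inl_def inr_def)

lemma casimir_group: "comm_group C"
  by (rule comm_groupI) (auto simp: T.m_ac intro!: bexI[of _ "inv\<^bsub>T\<^esub> _"])

text \<open>Inner and outer actions commute, so inner multiplication keeps the condition
  \<open>outl a e = outr a e\<close>; the module laws are inherited from \<open>T\<close>.\<close>

lemma casimir_bimodule: "bimodule R R C"
  unfolding bimodule_def left_module_def right_module_def
  by (simp add: casimir_group centralizer_ring actions_commute inner_one inner_module)

section \<open>The bimodule of \<open>B\<close>-bilinear maps from \<open>A\<close> to
  \<open>B\<close>\<close>

lemma hat_iff:
  "F \<in> carrier H \<longleftrightarrow> F \<in> carrier A \<rightarrow>\<^sub>E carrier B \<and>
     (\<forall>x\<in>carrier A. \<forall>y\<in>carrier A. F (x \<oplus>\<^bsub>A\<^esub> y) = F x \<oplus>\<^bsub>B\<^esub> F y) \<and>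
     (\<forall>b\<in>carrier B. \<forall>x\<in>carrier A. F (h b \<otimes>\<^bsub>A\<^esub> x) = b \<otimes>\<^bsub>B\<^esub> F x \<and> F (x \<otimes>\<^bsub>A\<^esub> h b) = F x \<otimes>\<^bsub>B\<^esub> b)"
  by (auto simp: hat_def bimod_hom_def left_hom_def right_hom_def hom_def PiE_def)

lemma hatD:
  assumes "F \<in> carrier H"
  shows "\<And>x. x \<in> carrier A \<Longrightarrow> F x \<in> carrier B"
    "\<And>x y. x \<in> carrier A \<Longrightarrow> y \<in> carrier A \<Longrightarrow> F (x \<oplus>\<^bsub>A\<^esub> y) = F x \<oplus>\<^bsub>B\<^esub> F y"
    "\<And>x b. x \<in> carrier A \<Longrightarrow> b \<in> carrier B \<Longrightarrow> F (h b \<otimes>\<^bsub>A\<^esub> x) = b \<otimes>\<^bsub>B\<^esub> F x"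
    "\<And>x b. x \<in> carrier A \<Longrightarrow> b \<in> carrier B \<Longrightarrow> F (x \<otimes>\<^bsub>A\<^esub> h b) = F x \<otimes>\<^bsub>B\<^esub> b"
  using assms unfolding hat_iff by auto

lemma hat_eqI:
  "F \<in> carrier H \<Longrightarrow> G \<in> carrier H \<Longrightarrow> (\<And>x. x \<in> carrier A \<Longrightarrow> F x = G x) \<Longrightarrow> F = G"
  unfolding hat_iff by (auto intro: PiE_ext)

lemma hat_sel:
  "F \<otimes>\<^bsub>H\<^esub> G = (\<lambda>a\<in>carrier A. F a \<oplus>\<^bsub>B\<^esub> G a)"
  "\<one>\<^bsub>H\<^esub> = (\<lambda>a\<in>carrier A. \<zero>\<^bsub>B\<^esub>)"
  "lact H r F = (\<lambda>a\<in>carrier A. F (a \<otimes>\<^bsub>A\<^esub> r))"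
  "ract H F r = (\<lambda>a\<in>carrier A. F (r \<otimes>\<^bsub>A\<^esub> a))"
  by (simp_all add: hat_def)

lemma hat_one_closed: "\<one>\<^bsub>H\<^esub> \<in> carrier H"
  by (simp add: hat_iff hat_sel)

lemma hat_mult_closed:
  assumes F: "F \<in> carrier H" and G: "G \<in> carrier H"
  shows "F \<otimes>\<^bsub>H\<^esub> G \<in> carrier H"
  unfolding hat_iff hat_sel by (simp add: hatD[OF F] hatD[OF G] B.a_ac B.r_distr B.l_distr)

lemma hat_inv_closed:
  assumes F: "F \<in> carrier H"
  shows "(\<lambda>a\<in>carrier A. \<ominus>\<^bsub>B\<^esub> F a) \<in> carrier H"
  unfolding hat_iff by (simp add: hatD[OF F] B.minus_add B.r_minus B.l_minus)

text \<open>The action multiplies the argument on the right, so right \<open>B\<close>-linearity is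
  at stake; moving \<open>h b\<close> past r restores it. In \<open>hat_ract_closed\<close> the same
  happens to left linearity.\<close>

lemma hat_lact_closed:
  assumes F: "F \<in> carrier H" and r: "r \<in> carrier R"
  shows "lact H r F \<in> carrier H"
proof -
  have "F (x \<otimes>\<^bsub>A\<^esub> h b \<otimes>\<^bsub>A\<^esub> r) = F (x \<otimes>\<^bsub>A\<^esub> r) \<otimes>\<^bsub>B\<^esub> b" if "x \<in> carrier A" "b \<in> carrier B" for x b
    using that r hatD(4)[OF F, of "x \<otimes>\<^bsub>A\<^esub> r" b] by (simp add: A.m_assoc centralizer_comm)
  then show ?thesis
    unfolding hat_iff hat_sel using r by (simp add: hatD[OF F] A.l_distr A.m_assoc)
qed

lemma hat_ract_closed:
  assumes F: "F \<in> carrier H" and r: "r \<in> carrier R"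
  shows "ract H F r \<in> carrier H"
proof -
  have "F (r \<otimes>\<^bsub>A\<^esub> (h b \<otimes>\<^bsub>A\<^esub> x)) = b \<otimes>\<^bsub>B\<^esub> F (r \<otimes>\<^bsub>A\<^esub> x)" if "x \<in> carrier A" "b \<in> carrier B" for x b
    using that r hatD(3)[OF F, of "r \<otimes>\<^bsub>A\<^esub> x" b] by (simp add: A.m_assoc[symmetric] centralizer_comm)
  moreover have "F (r \<otimes>\<^bsub>A\<^esub> (x \<otimes>\<^bsub>A\<^esub> h b)) = F (r \<otimes>\<^bsub>A\<^esub> x) \<otimes>\<^bsub>B\<^esub> b" if "x \<in> carrier A" "b \<in> carrier B" for x b
    using that r hatD(4)[OF F, of "r \<otimes>\<^bsub>A\<^esub> x" b] by (simp add: A.m_assoc)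
  ultimately show ?thesis
    unfolding hat_iff hat_sel using r by (simp add: hatD[OF F] A.r_distr)
qed

lemma hat_group: "comm_group H"
proof (rule comm_groupI)
  fix F assume F: "F \<in> carrier H"
  show "\<exists>G\<in>carrier H. G \<otimes>\<^bsub>H\<^esub> F = \<one>\<^bsub>H\<^esub>"
  proof (rule bexI[OF _ hat_inv_closed[OF F]])
    show "(\<lambda>a\<in>carrier A. \<ominus>\<^bsub>B\<^esub> F a) \<otimes>\<^bsub>H\<^esub> F = \<one>\<^bsub>H\<^esub>"
      by (rule hat_eqI) (simp_all add: hat_mult_closed hat_inv_closed hat_one_closed F,
        simp add: hat_sel hatD[OF F] B.l_neg)
  qed
  show "\<one>\<^bsub>H\<^esub> \<otimes>\<^bsub>H\<^esub> F = F"
    by (rule hat_eqI) (simp_all add: hat_mult_closed hat_one_closed F, simp add: hat_sel hatD[OF F])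
next
  fix F G assume F: "F \<in> carrier H" and G: "G \<in> carrier H"
  show "F \<otimes>\<^bsub>H\<^esub> G = G \<otimes>\<^bsub>H\<^esub> F"
    by (rule hat_eqI) (simp_all add: hat_mult_closed F G, simp add: hat_sel hatD[OF F] hatD[OF G] B.a_ac)
  fix E assume E: "E \<in> carrier H"
  show "F \<otimes>\<^bsub>H\<^esub> G \<otimes>\<^bsub>H\<^esub> E = F \<otimes>\<^bsub>H\<^esub> (G \<otimes>\<^bsub>H\<^esub> E)"
    by (rule hat_eqI)
      (simp_all add: hat_mult_closed E F G, simp add: hat_sel hatD[OF F] hatD[OF G] hatD[OF E] B.a_ac)
qed (simp_all add: hat_mult_closed hat_one_closed)

lemma hat_module_one:
  assumes "F \<in> carrier H"
  shows "lact H \<one>\<^bsub>A\<^esub> F = F" "ract H F \<one>\<^bsub>A\<^esub> = F"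
  using assms by (auto simp: fun_eq_iff hat_sel hat_iff PiE_def extensional_def)

lemma hat_module:
  assumes F: "F \<in> carrier H" and r: "r \<in> carrier R" and s: "s \<in> carrier R"
  shows "lact H (r \<oplus>\<^bsub>A\<^esub> s) F = lact H r F \<otimes>\<^bsub>H\<^esub> lact H s F"
    "ract H F (r \<oplus>\<^bsub>A\<^esub> s) = ract H F r \<otimes>\<^bsub>H\<^esub> ract H F s"
    "lact H (r \<otimes>\<^bsub>A\<^esub> s) F = lact H r (lact H s F)"
    "ract H F (r \<otimes>\<^bsub>A\<^esub> s) = ract H (ract H F r) s"
    "ract H (lact H r F) s = lact H r (ract H F s)"
proof -
  show "lact H (r \<oplus>\<^bsub>A\<^esub> s) F = lact H r F \<otimes>\<^bsub>H\<^esub> lact H s F"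
    "ract H F (r \<oplus>\<^bsub>A\<^esub> s) = ract H F r \<otimes>\<^bsub>H\<^esub> ract H F s"
    "lact H (r \<otimes>\<^bsub>A\<^esub> s) F = lact H r (lact H s F)"
    "ract H F (r \<otimes>\<^bsub>A\<^esub> s) = ract H (ract H F r) s"
    "ract H (lact H r F) s = lact H r (ract H F s)"
    using r s by (auto simp: fun_eq_iff hat_sel hatD[OF F] A.r_distr A.l_distr A.m_assoc)
qed

lemma hat_module_add:
  assumes F: "F \<in> carrier H" and G: "G \<in> carrier H" and r: "r \<in> carrier R"
  shows "lact H r (F \<otimes>\<^bsub>H\<^esub> G) = lact H r F \<otimes>\<^bsub>H\<^esub> lact H r G"
    "ract H (F \<otimes>\<^bsub>H\<^esub> G) r = ract H F r \<otimes>\<^bsub>H\<^esub> ract H G r"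
  using r by (auto simp: fun_eq_iff hat_sel)

lemma hat_bimodule: "bimodule R R H"
  unfolding bimodule_def left_module_def right_module_def
  by (simp add: hat_group centralizer_ring hat_lact_closed hat_ract_closed hat_module hat_module_one hat_module_add)

subsection \<open>The pairings\<close>

text \<open>As for \<open>phi\<close>, the domain is all of \<open>T\<close> and the values lie in
  \<open>A\<close>, so that identities can be checked on pure tensors. On \<open>C\<close> the
  values fall into \<open>R\<close>, by \<open>psi_casimir\<close>.\<close>

definition psi :: "('a \<Rightarrow> 'b) \<Rightarrow> ('a \<times> 'a \<Rightarrow>\<^sub>0 int) set \<Rightarrow> 'a" where
  "psi F = tensor_lift B L N (add_monoid A) (\<lambda>x y. x \<otimes>\<^bsub>A\<^esub> h (F y))"

definition phi :: "('a \<Rightarrow> 'b) \<Rightarrow> ('a \<times> 'a \<Rightarrow>\<^sub>0 int) set \<Rightarrow> 'a" where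
  "phi F = tensor_lift B L N (add_monoid A) (\<lambda>x y. h (F x) \<otimes>\<^bsub>A\<^esub> y)"

lemma lift_simps:
  assumes "f \<in> hom T (add_monoid A)"
  shows "f \<one>\<^bsub>T\<^esub> = \<zero>\<^bsub>A\<^esub>" "\<And>X. X \<in> carrier T \<Longrightarrow> f X \<in> carrier A"
    "\<And>X Y. X \<in> carrier T \<Longrightarrow> Y \<in> carrier T \<Longrightarrow> f (X \<otimes>\<^bsub>T\<^esub> Y) = f X \<oplus>\<^bsub>A\<^esub> f Y"
  using hom_one[OF assms T.is_group A.add.is_group] hom_mult[OF assms] hom_in_carrier[OF assms] by simp_all

lemma psi:
  assumes F: "F \<in> carrier H"
  shows psi_hom: "psi F \<in> hom T (add_monoid A)"
    and psi_tens [simp]: "\<And>x y. x \<in> carrier A \<Longrightarrow> y \<in> carrier A \<Longrightarrow> psi F (x \<otimes>\<^sub>B y) = x \<otimes>\<^bsub>A\<^esub> h (F y)"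
proof -
  have "balanced B L N (add_monoid A) (\<lambda>x y. x \<otimes>\<^bsub>A\<^esub> h (F y))"
    by (rule balancedI) (simp_all add: hatD[OF F] A.l_distr A.r_distr A.m_assoc)
  from AA.tensor_lift[OF A.a_comm_group this]
  show "psi F \<in> hom T (add_monoid A)"
    "\<And>x y. x \<in> carrier A \<Longrightarrow> y \<in> carrier A \<Longrightarrow> psi F (x \<otimes>\<^sub>B y) = x \<otimes>\<^bsub>A\<^esub> h (F y)"
    by (simp_all add: psi_def)
qed

lemma phi:
  assumes F: "F \<in> carrier H"
  shows phi_hom: "phi F \<in> hom T (add_monoid A)"
    and phi_tens [simp]: "\<And>x y. x \<in> carrier A \<Longrightarrow> y \<in> carrier A \<Longrightarrow> phi F (x \<otimes>\<^sub>B y) = h (F x) \<otimes>\<^bsub>A\<^esub> y"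
proof -
  have "balanced B L N (add_monoid A) (\<lambda>x y. h (F x) \<otimes>\<^bsub>A\<^esub> y)"
    by (rule balancedI) (simp_all add: hatD[OF F] A.l_distr A.r_distr A.m_assoc)
  from AA.tensor_lift[OF A.a_comm_group this]
  show "phi F \<in> hom T (add_monoid A)"
    "\<And>x y. x \<in> carrier A \<Longrightarrow> y \<in> carrier A \<Longrightarrow> phi F (x \<otimes>\<^sub>B y) = h (F x) \<otimes>\<^bsub>A\<^esub> y"
    by (simp_all add: phi_def)
qed

lemmas psi_phi_simps [simp] = lift_simps[OF psi_hom] lift_simps[OF phi_hom]

lemma hat_apply:
  assumes "a \<in> carrier A"
  shows "(F \<otimes>\<^bsub>H\<^esub> G) a = F a \<oplus>\<^bsub>B\<^esub> G a" "(lact H r F) a = F (a \<otimes>\<^bsub>A\<^esub> r)" "(ract H F r) a = F (r \<otimes>\<^bsub>A\<^esub> a)"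
  using assms by (simp_all add: hat_sel)

text \<open>Rules for e^1 F(e^2) with e an arbitrary tensor. The third and the fourth move a ring
  element from F into the tensor; the fifth is right \<open>B\<close>-linearity of F. With the first
  rule and the Casimir condition, the third becomes left \<open>R\<close>-linearity and the fifth
  shows that values on \<open>C\<close> commute with \<open>B\<close>.\<close>

lemma psi_actions:
  assumes F: "F \<in> carrier H" and X: "X \<in> carrier T"
  shows "\<And>a. a \<in> carrier A \<Longrightarrow> psi F (outl a X) = a \<otimes>\<^bsub>A\<^esub> psi F X"
    "\<And>r. r \<in> carrier R \<Longrightarrow> psi F (inr r X) = psi F X \<otimes>\<^bsub>A\<^esub> r"
    "\<And>r. r \<in> carrier R \<Longrightarrow> psi (lact H r F) X = psi F (outr r X)"
    "\<And>r. r \<in> carrier R \<Longrightarrow> psi (ract H F r) X = psi F (inl r X)"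
    "\<And>b. b \<in> carrier B \<Longrightarrow> psi F (outr (h b) X) = psi F X \<otimes>\<^bsub>A\<^esub> h b"
  using X by (induction X rule: AA.tensor_induct)
    (simp_all add: F hatD[OF F] hat_lact_closed hat_ract_closed A.m_assoc A.l_distr A.r_distr
      centralizer_comm hat_apply)

lemma phi_actions:
  assumes F: "F \<in> carrier H" and X: "X \<in> carrier T"
  shows "\<And>a. a \<in> carrier A \<Longrightarrow> phi F (outr a X) = phi F X \<otimes>\<^bsub>A\<^esub> a"
    "\<And>r. r \<in> carrier R \<Longrightarrow> phi F (inl r X) = r \<otimes>\<^bsub>A\<^esub> phi F X"
    "\<And>r. r \<in> carrier R \<Longrightarrow> phi (lact H r F) X = phi F (inr r X)"
    "\<And>r. r \<in> carrier R \<Longrightarrow> phi (ract H F r) X = phi F (outl r X)"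
    "\<And>b. b \<in> carrier B \<Longrightarrow> phi F (outl (h b) X) = h b \<otimes>\<^bsub>A\<^esub> phi F X"
  using X by (induction X rule: AA.tensor_induct)
    (simp_all add: F hatD[OF F] hat_lact_closed hat_ract_closed A.m_assoc[symmetric] A.l_distr A.r_distr
      centralizer_comm hat_apply)

lemma psi_phi_add:
  assumes F: "F \<in> carrier H" and G: "G \<in> carrier H" and X: "X \<in> carrier T"
  shows "psi (F \<otimes>\<^bsub>H\<^esub> G) X = psi F X \<oplus>\<^bsub>A\<^esub> psi G X" "phi (F \<otimes>\<^bsub>H\<^esub> G) X = phi F X \<oplus>\<^bsub>A\<^esub> phi G X"
  using X by (induction X rule: AA.tensor_induct)
    (simp_all add: F G hatD[OF F] hatD[OF G] hat_mult_closed A.a_ac A.l_distr A.r_distr hat_apply)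

lemma casimirD: "e \<in> carrier C \<Longrightarrow> a \<in> carrier A \<Longrightarrow> outr a e = outl a e"
  by simp

text \<open>e^1 F(e^2 r) = r e^1 F(e^2), because e r = r e.\<close>

lemma psi_lact:
  assumes "F \<in> carrier H" "e \<in> carrier C" "r \<in> carrier R"
  shows "psi (lact H r F) e = r \<otimes>\<^bsub>A\<^esub> psi F e"
proof -
  have e: "e \<in> carrier T" using assms by simp
  then show ?thesis
    using assms(1,3) psi_actions(1)[OF assms(1) e, of r] psi_actions(3)[OF assms(1) e, of r]
      casimirD[OF assms(2), of r] by simp
qed

lemma psi_casimir:
  assumes "F \<in> carrier H" "e \<in> carrier C"
  shows "psi F e \<in> carrier R"
  unfolding centralizer_iff
proof (intro conjI ballI)
  show "psi F e \<in> carrier A" using assms by simp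
  fix b assume "b \<in> carrier B"
  then show "h b \<otimes>\<^bsub>A\<^esub> psi F e = psi F e \<otimes>\<^bsub>A\<^esub> h b"
    using assms psi_actions(1)[of F e "h b"] psi_actions(5)[of F e b] by simp
qed

lemma phi_casimir:
  assumes "F \<in> carrier H" "e \<in> carrier C"
  shows "phi F e \<in> carrier R"
  unfolding centralizer_iff
proof (intro conjI ballI)
  show "phi F e \<in> carrier A" using assms by simp
  fix b assume "b \<in> carrier B"
  then show "h b \<otimes>\<^bsub>A\<^esub> phi F e = phi F e \<otimes>\<^bsub>A\<^esub> h b"
    using assms phi_actions(1)[of F e "h b"] phi_actions(5)[of F e b] by simp
qed

lemma Psi_eq: "Psi B A h = tensor_lift R H C (add_monoid R) psi"
  by (simp add: Psi_def psi_def[abs_def])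

lemma Phi_eq: "Phi B A h = tensor_lift R C H (add_monoid R) (\<lambda>e F. phi F e)"
  by (simp add: Phi_def phi_def)

sublocale HC: tensor_factors R H C
  using hat_bimodule casimir_bimodule by (simp add: tensor_factors_modules bimodule_def)

sublocale CH: tensor_factors R C H
  using hat_bimodule casimir_bimodule by (simp add: tensor_factors_modules bimodule_def)

lemma psi_balanced: "balanced R H C (add_monoid R) psi"
  by (rule balancedI) (use psi_casimir in \<open>simp_all add: psi_phi_add psi_actions\<close>)

lemma phi_balanced: "balanced R C H (add_monoid R) (\<lambda>e F. phi F e)"
  by (rule balancedI) (use phi_casimir in \<open>simp_all add: psi_phi_add phi_actions\<close>)

lemma Psi_tens: "F \<in> carrier H \<Longrightarrow> e \<in> carrier C \<Longrightarrow> Psi B A h (tens R H C F e) = psi F e"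
  unfolding Psi_eq by (rule HC.tensor_lift_tens[OF R.a_comm_group psi_balanced])

lemma Phi_tens: "F \<in> carrier H \<Longrightarrow> e \<in> carrier C \<Longrightarrow> Phi B A h (tens R C H e F) = phi F e"
  unfolding Phi_eq by (rule CH.tensor_lift_tens[OF R.a_comm_group phi_balanced])

lemma Psi_bimod_hom: "Psi B A h \<in> bimod_hom R R (tensor R H C) (regular_bimod R)"
  unfolding Psi_eq
  by (rule tensor_lift_bimod_hom[OF hat_bimodule casimir_bimodule centralizer_ring _ _ psi_balanced])
    (simp_all add: psi_lact[simplified] psi_actions)

lemma Phi_bimod_hom: "Phi B A h \<in> bimod_hom R R (tensor R C H) (regular_bimod R)"
  unfolding Phi_eq
  by (rule tensor_lift_bimod_hom[OF casimir_bimodule hat_bimodule centralizer_ring _ _ phi_balanced])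
    (simp_all add: phi_actions)

section \<open>The associativity laws\<close>

lemma phi_psi_comm:
  assumes E: "E \<in> carrier H" and F: "F \<in> carrier H" and "X \<in> carrier T"
  shows "E (phi F X) = F (psi E X)"
proof -
  have "E \<zero>\<^bsub>A\<^esub> = \<zero>\<^bsub>B\<^esub>" "F \<zero>\<^bsub>A\<^esub> = \<zero>\<^bsub>B\<^esub>"
    using hatD(3)[OF E, of "\<zero>\<^bsub>A\<^esub>" "\<zero>\<^bsub>B\<^esub>"] hatD(3)[OF F, of "\<zero>\<^bsub>A\<^esub>" "\<zero>\<^bsub>B\<^esub>"] hatD(1)[OF E] hatD(1)[OF F]
    by simp_all
  \<comment> \<open>On a pure tensor x \<otimes> y both sides equal F x times E y, by left
    \<open>B\<close>-linearity of E and right \<open>B\<close>-linearity of F.\<close>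
  with assms(3) show ?thesis
    by (induction X rule: AA.tensor_induct) (simp_all add: E F hatD[OF E] hatD[OF F])
qed

lemma Psi_Phi_assoc_hat:
  assumes E: "E \<in> carrier H" and e: "e \<in> carrier C" and F: "F \<in> carrier H"
  shows "ract H E (phi F e) = lact H (psi E e) F"
proof (rule hat_eqI)
  fix a assume a: "a \<in> carrier A"
  have eT: "e \<in> carrier T" using e by simp
  \<comment> \<open>The element a enters e on the right and leaves it on the left. In between,
    \<open>phi_psi_comm\<close> is applied to a e, a tensor that need not be Casimir.\<close>
  have "E (phi F e \<otimes>\<^bsub>A\<^esub> a) = E (phi F (outl a e))"
    using phi_actions(1)[OF F eT a] casimirD[OF e a] by simp
  also have "\<dots> = F (psi E (outl a e))"
    by (rule phi_psi_comm) (use eT a E F in simp_all)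
  also have "\<dots> = F (a \<otimes>\<^bsub>A\<^esub> psi E e)"
    using psi_actions(1)[OF E eT a] by simp
  finally show "ract H E (phi F e) a = lact H (psi E e) F a"
    using a by (simp add: hat_apply)
qed (use assms psi_casimir phi_casimir hat_lact_closed hat_ract_closed in auto)

text \<open>
  The map \<open>u \<otimes> v \<mapsto> u \<otimes> phi F (v X)\<close>. It mediates between the two sides of the associativity
  law on \<open>C\<close>: for a Casimir element \<open>X\<close> it is the inner action of \<open>phi F X\<close>, while for
  \<open>X = x \<otimes> y\<close> its value at a Casimir element \<open>f\<close> is \<open>x psi F f \<otimes> y\<close>.
\<close>

definition lam :: "('a \<Rightarrow> 'b) \<Rightarrow> ('a \<times> 'a \<Rightarrow>\<^sub>0 int) set \<Rightarrow> ('a \<times> 'a \<Rightarrow>\<^sub>0 int) set \<Rightarrow> ('a \<times> 'a \<Rightarrow>\<^sub>0 int) set" where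
  "lam F X = tensor_lift B L N T (\<lambda>u v. u \<otimes>\<^sub>B phi F (outl v X))"

lemma outl_mult:
  assumes "X \<in> carrier T" "a \<in> carrier A" "c \<in> carrier A"
  shows "outl (a \<otimes>\<^bsub>A\<^esub> c) X = outl a (outl c X)"
  using assms(1) by (induction X rule: AA.tensor_induct) (use assms(2-) in \<open>simp_all add: A.m_assoc\<close>)

lemma outl_add:
  assumes "X \<in> carrier T" "a \<in> carrier A" "c \<in> carrier A"
  shows "outl (a \<oplus>\<^bsub>A\<^esub> c) X = outl a X \<otimes>\<^bsub>T\<^esub> outl c X"
  using assms(1)
proof (induction X rule: AA.tensor_induct)
  case (tens x y)
  then show ?case
    using AA.tens_add_left[of "a \<otimes>\<^bsub>A\<^esub> x" "c \<otimes>\<^bsub>A\<^esub> x" y] assms by (simp add: A.l_distr)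
qed (use assms in \<open>simp_all add: T.m_ac\<close>)

text \<open>Balancing over \<open>B\<close> comes from the last rule of \<open>phi_actions\<close>:
  a scalar b inside \<open>phi F\<close> of b v X comes out in front and crosses the tensor
  sign.\<close>

lemma lam:
  assumes F: "F \<in> carrier H" and X: "X \<in> carrier T"
  shows lam_hom: "lam F X \<in> hom T T"
    and lam_tens: "\<And>u v. u \<in> carrier A \<Longrightarrow> v \<in> carrier A \<Longrightarrow> lam F X (u \<otimes>\<^sub>B v) = u \<otimes>\<^sub>B phi F (outl v X)"
proof -
  have "balanced B L N T (\<lambda>u v. u \<otimes>\<^sub>B phi F (outl v X))"
  proof (rule balancedI)
    fix m m' n assume "m \<in> carrier L" "m' \<in> carrier L" "n \<in> carrier N"
    then show "(m \<otimes>\<^bsub>L\<^esub> m') \<otimes>\<^sub>B phi F (outl n X)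
        = (m \<otimes>\<^sub>B phi F (outl n X)) \<otimes>\<^bsub>T\<^esub> (m' \<otimes>\<^sub>B phi F (outl n X))"
      using F X by (intro AA.tens_add_left) simp_all
  next
    fix m n n' assume "m \<in> carrier L" "n \<in> carrier N" "n' \<in> carrier N"
    then show "m \<otimes>\<^sub>B phi F (outl (n \<otimes>\<^bsub>N\<^esub> n') X)
        = (m \<otimes>\<^sub>B phi F (outl n X)) \<otimes>\<^bsub>T\<^esub> (m \<otimes>\<^sub>B phi F (outl n' X))"
      using F X AA.tens_add_right[of m "phi F (outl n X)" "phi F (outl n' X)"] by (simp add: outl_add)
  next
    fix m s n assume "m \<in> carrier L" "s \<in> carrier B" "n \<in> carrier N"
    then show "ract L m s \<otimes>\<^sub>B phi F (outl n X) = m \<otimes>\<^sub>B phi F (outl (lact N s n) X)"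
      using F X AA.tens_balance[of m s "phi F (outl n X)"] by (simp add: outl_mult phi_actions)
  qed (use F X in simp)
  from AA.tensor_lift[OF T.comm_group_axioms this]
  show "lam F X \<in> hom T T"
    "\<And>u v. u \<in> carrier A \<Longrightarrow> v \<in> carrier A \<Longrightarrow> lam F X (u \<otimes>\<^sub>B v) = u \<otimes>\<^sub>B phi F (outl v X)"
    by (simp_all add: lam_def)
qed

lemmas lam_simps = hom_simps[OF lam_hom]

text \<open>For a Casimir element e one has F(v e^1) e^2 = F(e^1) e^2 v, so \<open>phi F e\<close>
  becomes a left factor of v.\<close>

lemma lam_casimir:
  assumes F: "F \<in> carrier H" and e: "e \<in> carrier C" and X: "X \<in> carrier T"
  shows "lam F e X = inl (phi F e) X"
proof -
  have eT: "e \<in> carrier T" using e by simp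
  show ?thesis
    using X
  proof (induction X rule: AA.tensor_induct)
    case (tens u v)
    then show ?case
      using F eT phi_casimir[OF F e] phi_actions(1)[OF F eT, of v] casimirD[OF e, of v]
      by (simp add: lam_tens)
  qed (use F eT phi_casimir[OF F e] in \<open>simp_all add: lam_simps\<close>)
qed

text \<open>With \<open>lam_mult\<close> this is additivity in the parameter tensor, which allows
  induction on the parameter while the argument is held fixed.\<close>

lemma lam_one:
  assumes F: "F \<in> carrier H" and X: "X \<in> carrier T"
  shows "lam F \<one>\<^bsub>T\<^esub> X = \<one>\<^bsub>T\<^esub>"
  using X
proof (induction X rule: AA.tensor_induct)
  case (tens u v)
  interpret f: group_hom N T "\<lambda>y. u \<otimes>\<^sub>B y"
    using AA.tens_hom_right[of u] tens AA.N_group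
    by (simp add: group_hom_def group_hom_axioms_def comm_group_def T.is_group)
  show ?case using tens F f.hom_one by (simp add: lam_tens)
qed (use F in \<open>simp_all add: lam_simps\<close>)

lemma lam_mult:
  assumes F: "F \<in> carrier H" and X: "X \<in> carrier T" and Y: "Y \<in> carrier T" and Z: "Z \<in> carrier T"
  shows "lam F (Y \<otimes>\<^bsub>T\<^esub> Z) X = lam F Y X \<otimes>\<^bsub>T\<^esub> lam F Z X"
  using X
proof (induction X rule: AA.tensor_induct)
  case (tens u v)
  then show ?case
    using F Y Z AA.tens_add_right[of u "phi F (outl v Y)" "phi F (outl v Z)"] by (simp add: lam_tens)
qed (use F Y Z in \<open>simp_all add: lam_simps T.m_ac\<close>)

text \<open>On u \<otimes> v the scalar F(v x) crosses the tensor sign from y to u, and u F(v x) is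
  the value of \<open>psi F\<close> at u \<otimes> v x.\<close>

lemma lam_pure:
  assumes F: "F \<in> carrier H" and X: "X \<in> carrier T" and xy: "x \<in> carrier A" "y \<in> carrier A"
  shows "lam F (x \<otimes>\<^sub>B y) X = psi F (outr x X) \<otimes>\<^sub>B y"
  using X
proof (induction X rule: AA.tensor_induct)
  case one
  interpret f: group_hom L T "\<lambda>x. x \<otimes>\<^sub>B y"
    using AA.tens_hom_left[of y] xy AA.M_group
    by (simp add: group_hom_def group_hom_axioms_def comm_group_def T.is_group)
  show ?case using xy F f.hom_one by (simp add: lam_simps)
next
  case (tens u v)
  then show ?case
    using F xy AA.tens_balance[of u "F (v \<otimes>\<^bsub>A\<^esub> x)" y] by (simp add: lam_tens hatD[OF F])
next
  case (mult X Y)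
  then show ?case
    using F xy AA.tens_add_left[of "psi F (outr x X)" "psi F (outr x Y)" y] by (simp add: lam_simps)
qed

lemma Psi_Phi_assoc_casimir:
  assumes F: "F \<in> carrier H" and e: "e \<in> carrier C" and f: "f \<in> carrier C"
  shows "ract C e (psi F f) = lact C (phi F e) f"
proof -
  have fT: "f \<in> carrier T" and eT: "e \<in> carrier T" using e f by simp_all
  note pR = psi_casimir[OF F f]
  \<comment> \<open>The value \<open>lam F e f\<close> is read off twice. Here the parameter varies
    over \<open>T\<close> and f supplies its Casimir property, f x = x f; at e this gives the right
    action on e. Then \<open>lam_casimir\<close>, with e as the Casimir element, gives the left
    action on f.\<close>
  have "lam F X f = inr (psi F f) X" if "X \<in> carrier T" for X
    using that
  proof (induction X rule: AA.tensor_induct)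
    case one
    then show ?case using lam_one[OF F fT] pR by simp
  next
    case (tens x y)
    then show ?case
      using lam_pure[OF F fT] casimirD[OF f, of x] psi_actions(1)[OF F fT] pR by simp
  next
    case (mult X Y)
    then show ?case using lam_mult[OF F fT] pR by simp
  qed
  then show ?thesis
    using lam_casimir[OF F e fT] eT by simp
qed

lemma morita_context_extension: "morita_context R R H C (Phi B A h) (Psi B A h)"
  unfolding morita_context_def
  using centralizer_ring hat_bimodule casimir_bimodule Phi_bimod_hom Psi_bimod_hom
  by (simp del: casimir_sel add: Psi_tens Phi_tens Psi_Phi_assoc_hat Psi_Phi_assoc_casimir)

end

section \<open>Surjectivity\<close>

lemma bimod_hom_hom: "f \<in> bimod_hom R S (tensor Q M N) (ring_bimod A g k) \<Longrightarrow> f \<in> hom (tensor_group Q M N) (add_monoid A)"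
  by (simp add: bimod_hom_def left_hom_def hom_def)

lemma tensor_image_ideal:
  assumes P: "bimodule R R P" and Q: "bimodule R R Q"
    and f: "f \<in> bimod_hom R R (tensor R P Q) (regular_bimod R)"
  shows "ideal (f ` carrier (tensor R P Q)) R"
proof -
  interpret R: ring R using P by (simp add: bimodule_def left_module_def)
  have PQ: "right_module R P" "left_module R Q" using P Q by (simp_all add: bimodule_def)
  interpret tensor_factors R P Q using PQ by (rule tensor_factors_modules)
  interpret T: comm_group "tensor_group R P Q" by (rule tensor_group_comm)
  interpret f: group_hom "tensor_group R P Q" "add_monoid R" f
    using bimod_hom_hom[OF f] by unfold_locales
  show ?thesis
  proof (rule idealI[OF R.ring_axioms])
    show "subgroup (f ` carrier (tensor R P Q)) (add_monoid R)"
      using f.img_is_subgroup by simp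
  next
    fix a r assume "a \<in> f ` carrier (tensor R P Q)" and r: "r \<in> carrier R"
    then obtain t where t: "t \<in> carrier (tensor_group R P Q)" "a = f t" by auto
    have "r \<otimes>\<^bsub>R\<^esub> a = f (lact (tensor R P Q) r t)" "a \<otimes>\<^bsub>R\<^esub> r = f (ract (tensor R P Q) t r)"
      using f t r by (simp_all add: bimod_hom_def left_hom_def right_hom_def)
    moreover have "lact (tensor R P Q) r t \<in> carrier (tensor_group R P Q)"
      "ract (tensor R P Q) t r \<in> carrier (tensor_group R P Q)"
      using tensor_lact_hom[OF P PQ(2) r] tensor_ract_hom[OF PQ(1) Q r] t by (auto simp: hom_def)
    ultimately show "r \<otimes>\<^bsub>R\<^esub> a \<in> f ` carrier (tensor R P Q)" "a \<otimes>\<^bsub>R\<^esub> r \<in> f ` carrier (tensor R P Q)"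
      by auto
  qed
qed

lemma tensor_image_onto:
  assumes "bimodule R R P" "bimodule R R Q" "f \<in> bimod_hom R R (tensor R P Q) (regular_bimod R)"
    and "\<one>\<^bsub>R\<^esub> \<in> f ` carrier (tensor R P Q)"
  shows "f ` carrier (tensor R P Q) = carrier R"
  using ideal.one_imp_carrier[OF tensor_image_ideal] assms by blast

subsection \<open>Simple rings\<close>

text \<open>The symmetry by which the simple case is argued for one of the two maps only.\<close>

lemma morita_context_swap: "morita_context R S P Q \<phi> \<psi> \<Longrightarrow> morita_context S R Q P \<psi> \<phi>"
  by (simp add: morita_context_def)

text \<open>If \<psi> vanished, associativity would give \<phi>(q' \<otimes> p) q = q' \<psi>(p
  \<otimes> q) = 0. As \<phi> takes the value 1, all of Q would be zero, and with it Q \<otimes> P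
  and \<phi>, against 1 \<noteq> 0.\<close>

lemma morita_context_nonzero:
  assumes mc: "morita_context R R P Q \<phi> \<psi>" and ne: "\<one>\<^bsub>R\<^esub> \<noteq> \<zero>\<^bsub>R\<^esub>"
    and onto: "\<one>\<^bsub>R\<^esub> \<in> \<phi> ` carrier (tensor R Q P)"
  shows "\<exists>t\<in>carrier (tensor R P Q). \<psi> t \<noteq> \<zero>\<^bsub>R\<^esub>"
proof (rule ccontr)
  assume "\<not> ?thesis"
  then have \<psi>0: "\<psi> t = \<zero>\<^bsub>R\<^esub>" if "t \<in> carrier (tensor_group R P Q)" for t
    using that by simp
  have bi: "left_module R P" "right_module R P" "left_module R Q" "right_module R Q"
    and \<phi>: "\<phi> \<in> hom (tensor_group R Q P) (add_monoid R)"
    using mc bimod_hom_hom by (auto simp: morita_context_def bimodule_def)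
  interpret R: ring R using mc by (simp add: morita_context_def)
  interpret PQ: tensor_factors R P Q using bi by (simp add: tensor_factors_modules)
  interpret QP: tensor_factors R Q P using bi by (simp add: tensor_factors_modules)
  interpret Q: comm_group Q by (rule QP.M_group)
  interpret T: comm_group "tensor_group R Q P" by (rule QP.tensor_group_comm)
  interpret \<phi>: group_hom "tensor_group R Q P" "add_monoid R" \<phi>
    using \<phi> by unfold_locales
  obtain t where t: "t \<in> carrier (tensor_group R Q P)" "\<phi> t = \<one>\<^bsub>R\<^esub>"
    using onto by auto
  have Q0: "q = \<one>\<^bsub>Q\<^esub>" if q: "q \<in> carrier Q" for q
  proof -
    have lact_hom: "(\<lambda>r. lact Q r q) \<in> hom (add_monoid R) Q"
      using bi(3) q by (auto simp: left_module_def hom_def)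
    have l0: "lact Q \<zero>\<^bsub>R\<^esub> q = \<one>\<^bsub>Q\<^esub>"
      using hom_one[OF lact_hom] R.add.is_group Q.is_group by simp
    \<comment> \<open>A preimage of 1 is in general a sum, so the vanishing is shown for every
      tensor \<open>X\<close> and then used at \<open>t\<close>.\<close>
    have "lact Q (\<phi> X) q = \<one>\<^bsub>Q\<^esub>" if "X \<in> carrier (tensor_group R Q P)" for X
      using that
    proof (induction X rule: QP.tensor_induct)
      case one
      then show ?case using \<phi>.hom_one by (simp add: l0)
    next
      case (tens q' p)
      have "(\<lambda>r. ract Q q' r) \<in> hom (add_monoid R) Q"
        using bi(4) tens by (auto simp: right_module_def hom_def)
      from hom_one[OF this] have r0: "ract Q q' \<zero>\<^bsub>R\<^esub> = \<one>\<^bsub>Q\<^esub>"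
        using R.add.is_group Q.is_group by simp
      have "ract Q q' (\<psi> (tens R P Q p q)) = lact Q (\<phi> (tens R Q P q' p)) q"
        using mc tens q by (simp add: morita_context_def)
      then show ?case using r0 tens q by (simp add: \<psi>0)
    next
      case (mult X Y)
      then show ?case
        using hom_mult[OF lact_hom, of "\<phi> X" "\<phi> Y"] \<phi>.hom_closed by simp
    qed
    from this[OF t(1)] show ?thesis
      using t bi(3) q by (simp add: left_module_def)
  qed
  have "\<phi> X = \<zero>\<^bsub>R\<^esub>" if "X \<in> carrier (tensor_group R Q P)" for X
    using that
  proof (induction X rule: QP.tensor_induct)
    case one
    then show ?case using \<phi>.hom_one by simp
  next
    case (tens q p)
    have "tens R Q P \<one>\<^bsub>Q\<^esub> p = \<one>\<^bsub>tensor_group R Q P\<^esub>"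
      using hom_one[OF QP.tens_hom_left[OF tens(2)]] Q.is_group T.is_group by simp
    then show ?case
      using Q0[OF tens(1)] \<phi>.hom_one by simp
  next
    case (mult X Y)
    then show ?case by simp
  qed
  then show False
    using t ne by simp
qed

lemma morita_context_simple:
  assumes mc: "morita_context R R P Q \<phi> \<psi>" and R: "simple_ring R"
    and nz: "\<exists>t\<in>carrier (tensor R Q P). \<phi> t \<noteq> \<zero>\<^bsub>R\<^esub>"
  shows "\<phi> ` carrier (tensor R Q P) = carrier R \<and> \<psi> ` carrier (tensor R P Q) = carrier R"
proof -
  interpret R: ring R using R by (simp add: simple_ring_def)
  have mc': "bimodule R R P" "bimodule R R Q"
    "\<phi> \<in> bimod_hom R R (tensor R Q P) (regular_bimod R)"
    "\<psi> \<in> bimod_hom R R (tensor R P Q) (regular_bimod R)"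
    using mc by (simp_all add: morita_context_def)
  have "\<phi> ` carrier (tensor R Q P) = carrier R"
    using R tensor_image_ideal[OF mc'(2,1,3)] nz by (fastforce simp: simple_ring_def)
  moreover from this have "\<exists>t\<in>carrier (tensor R P Q). \<psi> t \<noteq> \<zero>\<^bsub>R\<^esub>"
    using R by (intro morita_context_nonzero[OF mc]) (simp_all add: simple_ring_def)
  then have "\<psi> ` carrier (tensor R P Q) = carrier R"
    using R tensor_image_ideal[OF mc'(1,2,4)] by (fastforce simp: simple_ring_def)
  ultimately show ?thesis by blast
qed

subsection \<open>Progenerators\<close>

text \<open>A finitely supported family is the sum of its single-entry families. The induction runs
  over a finite set containing the support and splits off one entry at a time; \<open>f\<close> is
  generalised because what remains is a new family.\<close>

lemma copower_decompose:
  fixes I :: "'i set"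
  assumes M: "comm_group M" and Q: "comm_group Q" and q: "q \<in> hom (copower I M) Q"
    and "finite J" "J \<subseteq> I" "f \<in> I \<rightarrow>\<^sub>E carrier M" "\<And>k. k \<in> I - J \<Longrightarrow> f k = \<one>\<^bsub>M\<^esub>"
  shows "q f = finprod Q (\<lambda>k. q (\<lambda>i\<in>I. if i = k then f k else \<one>\<^bsub>M\<^esub>)) J"
  using assms(4-)
proof (induction J arbitrary: f)
  case empty
  interpret M: comm_group M by fact
  interpret Q: comm_group Q by fact
  have c: "f \<in> carrier (copower I M)"
    using empty by (simp add: copower_def cong: conj_cong)
  \<comment> \<open>Here f is the zero family. From f + f = f its image is idempotent, hence zero:
    additivity of q gives this without a group structure on the copower.\<close>
  have "f \<otimes>\<^bsub>copower I M\<^esub> f = f"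
    using empty by (auto simp: copower_def PiE_def extensional_def fun_eq_iff)
  then have "q f \<otimes>\<^bsub>Q\<^esub> q f = q f"
    using hom_mult[OF q c c] by simp
  then show ?case
    using hom_in_carrier[OF q c] Q.r_cancel_one by simp
next
  case (insert k J)
  interpret M: comm_group M by fact
  interpret Q: comm_group Q by fact
  let ?s = "\<lambda>m. \<lambda>i\<in>I. if i = k then m else \<one>\<^bsub>M\<^esub>"
  let ?d = "\<lambda>f j. \<lambda>i\<in>I. if i = j then f j else \<one>\<^bsub>M\<^esub>"
  define g where "g = (\<lambda>i\<in>I. if i = k then \<one>\<^bsub>M\<^esub> else f i)"
  have fc: "f i \<in> carrier M" if "i \<in> I" for i using insert.prems(2) that by auto
  have single: "?d f' j \<in> carrier (copower I M)" if "j \<in> I" "f' j \<in> carrier M" for j f'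
  proof -
    have "{i \<in> I. ?d f' j i \<noteq> \<one>\<^bsub>M\<^esub>} \<subseteq> {j}" by auto
    then show ?thesis using that by (auto simp: copower_def intro: finite_subset)
  qed
  have gI: "g \<in> I \<rightarrow>\<^sub>E carrier M" using fc by (auto simp: g_def)
  have g1: "g i = \<one>\<^bsub>M\<^esub>" if "i \<in> I - J" for i
    using insert that by (auto simp: g_def)
  have "{i \<in> I. g i \<noteq> \<one>\<^bsub>M\<^esub>} \<subseteq> J" using g1 by auto
  then have gc: "g \<in> carrier (copower I M)"
    using gI insert.hyps(1) by (simp add: copower_def finite_subset)
  have k: "k \<in> I" using insert by auto
  have "f = ?d f k \<otimes>\<^bsub>copower I M\<^esub> g"
    using insert.prems(2) fc by (auto simp: copower_def g_def fun_eq_iff PiE_def extensional_def)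
  then have "q f = q (?d f k) \<otimes>\<^bsub>Q\<^esub> q g"
    using hom_mult[OF q single[of k f] gc] fc k by simp
  also have "q g = finprod Q (\<lambda>j. q (?d g j)) J"
    by (rule insert.IH[OF _ gI g1]) (use insert.prems in auto)
  also have "\<dots> = finprod Q (\<lambda>j. q (?d f j)) J"
  proof (rule Q.finprod_cong')
    have "?d g j = ?d f j" if "j \<in> J" for j
      using that insert.hyps(2) insert.prems(1) by (auto simp: g_def fun_eq_iff)
    then show "q (?d g j) = q (?d f j)" if "j \<in> J" for j using that by simp
    show "(\<lambda>j. q (?d f j)) \<in> J \<rightarrow> carrier Q"
      using insert.prems(1) fc by (auto intro!: hom_in_carrier[OF q] single)
  qed simp
  also have "q (?d f k) \<otimes>\<^bsub>Q\<^esub> finprod Q (\<lambda>j. q (?d f j)) J = finprod Q (\<lambda>j. q (?d f j)) (insert k J)"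
    using insert.prems(1) fc insert.hyps
    by (intro Q.finprod_insert[symmetric]) (auto intro!: hom_in_carrier[OF q] single)
  finally show ?case .
qed

text \<open>For a direct summand of a free module, the functionals are the coordinates of the
  embedding \<open>i\<close>, and the elements are the images under \<open>q\<close> of the unit
  vectors. Finite generation cuts the index set down to a finite one.\<close>

lemma right_dual_basis:
  fixes P :: "('l, 'r, 'm, 'y) bimod_scheme"
  assumes P: "right_module S P" and fg: "right_fin_gen S P" and proj: "right_projective S P"
  obtains J :: "'m set" and x \<phi> where "finite J" "\<And>j. j \<in> J \<Longrightarrow> x j \<in> carrier P"
    "\<And>j. j \<in> J \<Longrightarrow> \<phi> j \<in> right_hom S P (regular_bimod S)"
    "\<And>p. p \<in> carrier P \<Longrightarrow> p = finprod P (\<lambda>j. ract P (x j) (\<phi> j p)) J"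
proof -
  interpret S: ring S using P by (simp add: right_module_def)
  interpret P: comm_group P using P by (simp add: right_module_def)
  have reg: "comm_group (regular_bimod S)"
    by (rule comm_group_cong[OF S.a_comm_group]) simp_all
  obtain X where X: "finite X" "X \<subseteq> carrier P"
    "\<And>p. p \<in> carrier P \<Longrightarrow> \<exists>c\<in>X \<rightarrow> carrier S. p = finprod P (\<lambda>x. ract P x (c x)) X"
    using fg unfolding right_fin_gen_def by blast
  obtain I :: "'m set" and i q where i: "i \<in> right_hom S P (copower I (regular_bimod S))"
    and q: "q \<in> right_hom S (copower I (regular_bimod S)) P"
    and qi: "\<And>p. p \<in> carrier P \<Longrightarrow> q (i p) = p"
    using proj unfolding right_projective_def right_summand_def by blast
  have ihom: "i \<in> hom P (copower I (regular_bimod S))" and qhom: "q \<in> hom (copower I (regular_bimod S)) P"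
    using i q by (simp_all add: right_hom_def)
  have ic: "i p \<in> I \<rightarrow>\<^sub>E carrier S" "finite {k \<in> I. i p k \<noteq> \<zero>\<^bsub>S\<^esub>}" if "p \<in> carrier P" for p
    using hom_in_carrier[OF ihom that] by (simp_all add: copower_def)
  \<comment> \<open>Each of the finitely many generators has finite support under \<open>i\<close>,
    so this union is finite. Coordinates outside it vanish on the generators and hence, by
    linearity, on all of P.\<close>
  define J where "J = (\<Union>x\<in>X. {k \<in> I. i x k \<noteq> \<zero>\<^bsub>S\<^esub>})"
  define \<phi> where "\<phi> = (\<lambda>k. \<lambda>p\<in>carrier P. i p k)"
  define \<delta> where "\<delta> = (\<lambda>k s. \<lambda>i\<in>I. if i = k then s else \<zero>\<^bsub>S\<^esub>)"
  have J: "finite J" "J \<subseteq> I" unfolding J_def using X ic by auto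
  have \<phi>: "\<phi> k \<in> right_hom S P (regular_bimod S)" if k: "k \<in> I" for k
  proof -
    have "\<phi> k p \<in> carrier S" if "p \<in> carrier P" for p
      using ic[OF that] k that by (auto simp: \<phi>_def)
    moreover have "\<phi> k (p \<otimes>\<^bsub>P\<^esub> p') = \<phi> k p \<oplus>\<^bsub>S\<^esub> \<phi> k p'" if "p \<in> carrier P" "p' \<in> carrier P" for p p'
      using hom_mult[OF ihom that] k that by (simp add: \<phi>_def copower_def)
    moreover have "\<phi> k (ract P p s) = \<phi> k p \<otimes>\<^bsub>S\<^esub> s" if "p \<in> carrier P" "s \<in> carrier S" for p s
    proof -
      have "i (ract P p s) = ract (copower I (regular_bimod S)) (i p) s"
        using i that by (simp add: right_hom_def)
      moreover have "ract P p s \<in> carrier P" using P that by (simp add: right_module_def)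
      ultimately show ?thesis using k that by (simp add: \<phi>_def copower_def)
    qed
    ultimately show ?thesis
      by (auto simp: right_hom_def hom_def \<phi>_def)
  qed
  have zero: "i p k = \<zero>\<^bsub>S\<^esub>" if p: "p \<in> carrier P" and k: "k \<in> I - J" for p k
  proof -
    obtain c where c: "c \<in> X \<rightarrow> carrier S" "p = finprod P (\<lambda>x. ract P x (c x)) X"
      using X(3)[OF p] by blast
    have h: "\<phi> k \<in> hom P (add_monoid S)"
      using \<phi>[of k] k by (simp add: right_hom_def hom_def)
    have x: "ract P x (c x) \<in> carrier P" if "x \<in> X" for x
      using P X(2) c(1) that by (auto simp: right_module_def)
    have "\<phi> k (ract P x (c x)) = \<zero>\<^bsub>S\<^esub>" if "x \<in> X" for x
    proof -
      have "\<phi> k (ract P x (c x)) = \<phi> k x \<otimes>\<^bsub>S\<^esub> c x"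
        using \<phi>[of k] k X(2) c(1) that by (auto simp: right_hom_def)
      moreover have "\<phi> k x = \<zero>\<^bsub>S\<^esub>"
        using k that X(2) by (auto simp: \<phi>_def J_def)
      ultimately show ?thesis using funcset_mem[OF c(1) that] by simp
    qed
    moreover have "\<phi> k p = finprod (add_monoid S) (\<lambda>x. \<phi> k (ract P x (c x))) X"
      unfolding c(2)
      by (rule hom_finprod[OF P.comm_monoid_axioms S.add.comm_monoid_axioms h])
        (use x hom_one[OF h P.is_group S.add.is_group] in auto)
    ultimately have "\<phi> k p = \<zero>\<^bsub>S\<^esub>"
      using comm_monoid.finprod_one_eqI[OF S.add.comm_monoid_axioms, of X] by simp
    then show ?thesis using p by (simp add: \<phi>_def)
  qed
  have \<delta>c: "\<delta> k s \<in> carrier (copower I (regular_bimod S))" if "s \<in> carrier S" for k s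
  proof -
    have "{i \<in> I. \<delta> k s i \<noteq> \<zero>\<^bsub>S\<^esub>} \<subseteq> {k}" by (auto simp: \<delta>_def)
    then show ?thesis using that by (auto simp: copower_def \<delta>_def intro: finite_subset)
  qed
  have \<delta>: "q (\<delta> k s) = ract P (q (\<delta> k \<one>\<^bsub>S\<^esub>)) s" if "s \<in> carrier S" for k s
  proof -
    have "\<delta> k s = ract (copower I (regular_bimod S)) (\<delta> k \<one>\<^bsub>S\<^esub>) s"
      using that by (auto simp: \<delta>_def copower_def fun_eq_iff)
    then show ?thesis
      using q that \<delta>c[of "\<one>\<^bsub>S\<^esub>" k] by (simp add: right_hom_def)
  qed
  have xP: "q (\<delta> j \<one>\<^bsub>S\<^esub>) \<in> carrier P" for j
    using hom_in_carrier[OF qhom \<delta>c] by simp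
  show ?thesis
  proof (rule that[of J "\<lambda>j. q (\<delta> j \<one>\<^bsub>S\<^esub>)" \<phi>])
    show "finite J" by (rule J)
    show "q (\<delta> j \<one>\<^bsub>S\<^esub>) \<in> carrier P" for j by (rule xP)
    show "\<phi> j \<in> right_hom S P (regular_bimod S)" if "j \<in> J" for j
      using that J \<phi> by auto
    fix p assume p: "p \<in> carrier P"
    have "p = finprod P (\<lambda>k. q (\<lambda>j\<in>I. if j = k then i p k else \<zero>\<^bsub>S\<^esub>)) J"
      using copower_decompose[OF reg P.comm_group_axioms qhom J, of "i p", unfolded ring_bimod_sel]
        ic(1)[OF p] zero[OF p] qi[OF p]
      by simp
    also have "\<dots> = finprod P (\<lambda>k. ract P (q (\<delta> k \<one>\<^bsub>S\<^esub>)) (\<phi> k p)) J"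
    proof (rule P.finprod_cong')
      fix k assume "k \<in> J"
      then have "i p k \<in> carrier S" using ic(1)[OF p] J by auto
      from \<delta>[OF this, of k]
      show "q (\<lambda>j\<in>I. if j = k then i p k else \<zero>\<^bsub>S\<^esub>) = ract P (q (\<delta> k \<one>\<^bsub>S\<^esub>)) (\<phi> k p)"
        using p by (simp add: \<delta>_def \<phi>_def)
    next
      show "(\<lambda>k. ract P (q (\<delta> k \<one>\<^bsub>S\<^esub>)) (\<phi> k p)) \<in> J \<rightarrow> carrier P"
      proof
        fix k assume "k \<in> J"
        then have "i p k \<in> carrier S" using ic(1)[OF p] J by auto
        then show "ract P (q (\<delta> k \<one>\<^bsub>S\<^esub>)) (\<phi> k p) \<in> carrier P"
          using P xP p by (simp add: right_module_def \<phi>_def)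
      qed
    qed simp
    finally show "p = finprod P (\<lambda>k. ract P (q (\<delta> k \<one>\<^bsub>S\<^esub>)) (\<phi> k p)) J" .
  qed
qed

text \<open>The trace ideal of a generator is the whole ring: 1 = q (i 1) splits into the entries of
  the finite power. The x k are the entries of i 1, and \<phi> k is q restricted to the k-th copy of
  P.\<close>

lemma right_generator_trace:
  assumes P: "right_module S P" and gen: "right_generator S P"
  obtains n :: nat and x \<phi> where "\<And>k. k < n \<Longrightarrow> x k \<in> carrier P"
    "\<And>k. k < n \<Longrightarrow> \<phi> k \<in> right_hom S P (regular_bimod S)"
    "\<one>\<^bsub>S\<^esub> = finprod (add_monoid S) (\<lambda>k. \<phi> k (x k)) {..<n}"
proof -
  interpret S: ring S using P by (simp add: right_module_def)
  interpret P: comm_group P using P by (simp add: right_module_def)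
  obtain n :: nat and i q where i: "i \<in> right_hom S (regular_bimod S) (copower {..<n} P)"
    and q: "q \<in> right_hom S (copower {..<n} P) (regular_bimod S)"
    and qi: "\<And>s. s \<in> carrier S \<Longrightarrow> q (i s) = s"
    using gen unfolding right_generator_def right_summand_def by auto
  have qhom: "q \<in> hom (copower {..<n} P) (add_monoid S)"
    using q by (simp add: right_hom_def hom_def)
  have "i \<in> hom (regular_bimod S) (copower {..<n} P)"
    using i by (simp add: right_hom_def)
  from hom_in_carrier[OF this, of "\<one>\<^bsub>S\<^esub>"]
  have ic: "i \<one>\<^bsub>S\<^esub> \<in> {..<n} \<rightarrow>\<^sub>E carrier P"
    by (simp add: copower_def)
  define \<delta> where "\<delta> = (\<lambda>k p. \<lambda>i\<in>{..<n}. if i = k then p else \<one>\<^bsub>P\<^esub>)"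
  define \<phi> where "\<phi> = (\<lambda>k. \<lambda>p\<in>carrier P. q (\<delta> k p))"
  have \<delta>c: "\<delta> k p \<in> carrier (copower {..<n} P)" if "p \<in> carrier P" for k p
    using that by (auto simp: copower_def \<delta>_def)
  have x: "i \<one>\<^bsub>S\<^esub> k \<in> carrier P" if "k < n" for k using ic that by auto
  show ?thesis
  proof (rule that[of n "i \<one>\<^bsub>S\<^esub>" \<phi>])
    show "i \<one>\<^bsub>S\<^esub> k \<in> carrier P" if "k < n" for k using x that .
    show "\<phi> k \<in> right_hom S P (regular_bimod S)" for k
    proof -
      have "\<phi> k (p \<otimes>\<^bsub>P\<^esub> p') = \<phi> k p \<oplus>\<^bsub>S\<^esub> \<phi> k p'" if p: "p \<in> carrier P" "p' \<in> carrier P" for p p'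
      proof -
        have "\<delta> k (p \<otimes>\<^bsub>P\<^esub> p') = \<delta> k p \<otimes>\<^bsub>copower {..<n} P\<^esub> \<delta> k p'"
          using p by (auto simp: \<delta>_def copower_def fun_eq_iff)
        then show ?thesis
          using hom_mult[OF qhom \<delta>c[OF p(1)] \<delta>c[OF p(2)]] p by (simp add: \<phi>_def)
      qed
      moreover have "\<phi> k (ract P p s) = \<phi> k p \<otimes>\<^bsub>S\<^esub> s" if p: "p \<in> carrier P" and s: "s \<in> carrier S" for p s
      proof -
        \<comment> \<open>Off position k the single-entry family is zero, so its compatibility with
          the action rests on scalars fixing zero.\<close>
        have "(\<lambda>p. ract P p s) \<in> hom P P" using P s by (simp add: right_module_def hom_def)
        from hom_one[OF this] have "ract P \<one>\<^bsub>P\<^esub> s = \<one>\<^bsub>P\<^esub>" by (simp add: P.is_group)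
        then have "\<delta> k (ract P p s) = ract (copower {..<n} P) (\<delta> k p) s"
          by (auto simp: \<delta>_def copower_def fun_eq_iff)
        moreover have "ract P p s \<in> carrier P" using P p s by (simp add: right_module_def)
        ultimately show ?thesis
          using q s p \<delta>c[OF p] by (simp add: right_hom_def \<phi>_def)
      qed
      moreover have "\<phi> k p \<in> carrier S" if "p \<in> carrier P" for p
        using hom_in_carrier[OF qhom \<delta>c[OF that]] that by (simp add: \<phi>_def)
      ultimately show ?thesis by (auto simp: right_hom_def hom_def \<phi>_def)
    qed
    have "\<one>\<^bsub>S\<^esub> = finprod (add_monoid S) (\<lambda>k. q (\<delta> k (i \<one>\<^bsub>S\<^esub> k))) {..<n}"
      using copower_decompose[OF P.comm_group_axioms S.a_comm_group qhom, of "{..<n}" "i \<one>\<^bsub>S\<^esub>"] ic qi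
      by (simp add: \<delta>_def)
    also have "\<dots> = finprod (add_monoid S) (\<lambda>k. \<phi> k (i \<one>\<^bsub>S\<^esub> k)) {..<n}"
      using x hom_in_carrier[OF qhom \<delta>c[OF x]] by (intro comm_monoid.finprod_cong'[OF S.add.comm_monoid_axioms]) (auto simp: \<phi>_def)
    finally show "\<one>\<^bsub>S\<^esub> = finprod (add_monoid S) (\<lambda>k. \<phi> k (i \<one>\<^bsub>S\<^esub> k)) {..<n}" .
  qed
qed

text \<open>As \<theta> is onto, every functional on P is represented by an element of Q. Such
  representatives turn the trace formula and the dual basis into tensors on which \<epsilon> and
  \<gamma> take the value 1.\<close>

lemma morita_dual_pair_one:
  fixes P :: "('r, 'r, 'p, 'y) bimod_scheme"
  assumes P: "bimodule R R P" and Q: "bimodule R R Q"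
    and \<epsilon>: "\<epsilon> \<in> bimod_hom R R (tensor R Q P) (regular_bimod R)"
    and \<gamma>: "\<gamma> \<in> bimod_hom R R (tensor R P Q) (regular_bimod R)"
    and dual: "morita_dual_pair R P Q \<epsilon> \<gamma>"
  shows "\<one>\<^bsub>R\<^esub> \<in> \<epsilon> ` carrier (tensor R Q P)" "\<one>\<^bsub>R\<^esub> \<in> \<gamma> ` carrier (tensor R P Q)"
proof -
  have mods: "left_module R P" "right_module R P" "left_module R Q" "right_module R Q"
    using P Q by (simp_all add: bimodule_def)
  interpret R: ring R using mods by (simp add: left_module_def)
  interpret PQ: tensor_factors R P Q using mods by (simp add: tensor_factors_modules)
  interpret QP: tensor_factors R Q P using mods by (simp add: tensor_factors_modules)
  interpret P: comm_group P by (rule PQ.M_group)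
  interpret TPQ: comm_group "tensor_group R P Q" by (rule PQ.tensor_group_comm)
  interpret TQP: comm_group "tensor_group R Q P" by (rule QP.tensor_group_comm)
  note \<epsilon>h = bimod_hom_hom[OF \<epsilon>] and \<gamma>h = bimod_hom_hom[OF \<gamma>]
  obtain \<theta> where \<theta>: "\<theta> \<in> bimod_iso R R Q (right_dual R P)"
    and \<epsilon>\<theta>: "\<And>q p. q \<in> carrier Q \<Longrightarrow> p \<in> carrier P \<Longrightarrow> \<epsilon> (tens R Q P q p) = \<theta> q p"
    and \<gamma>\<theta>: "\<And>p q. p \<in> carrier P \<Longrightarrow> q \<in> carrier Q \<Longrightarrow>
      (\<lambda>x\<in>carrier P. lact P (\<gamma> (tens R P Q p q)) x) = (\<lambda>x\<in>carrier P. ract P p (\<theta> q x))"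
    using dual unfolding morita_dual_pair_def by blast
  have progen: "right_fin_gen R P" "right_projective R P" "right_generator R P"
    and iso: "(\<lambda>r. \<lambda>p\<in>carrier P. lact P r p) \<in> ring_iso R (right_End R P)"
    using dual by (simp_all add: morita_dual_pair_def right_progenerator_def)
  have "\<theta> ` carrier Q = right_hom R P (regular_bimod R)"
    using \<theta> by (simp add: bimod_iso_def right_dual_def bij_betw_def)
  then have onto: "\<exists>q\<in>carrier Q. \<theta> q = f" if "f \<in> right_hom R P (regular_bimod R)" for f
    using that by (metis imageE)
  show "\<one>\<^bsub>R\<^esub> \<in> \<epsilon> ` carrier (tensor R Q P)"
  proof -
    obtain n :: nat and x \<phi> where x: "\<And>k. k < n \<Longrightarrow> x k \<in> carrier P"
      and \<phi>: "\<And>k. k < n \<Longrightarrow> \<phi> k \<in> right_hom R P (regular_bimod R)"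
      and one: "\<one>\<^bsub>R\<^esub> = finprod (add_monoid R) (\<lambda>k. \<phi> k (x k)) {..<n}"
    proof (rule right_generator_trace[OF mods(2) progen(3)], goal_cases)
      case (1 n x \<phi>)
      show ?case by (rule 1(1)[OF 1(2-4)])
    qed
    have "\<forall>k\<in>{..<n}. \<exists>q. q \<in> carrier Q \<and> \<theta> q = \<phi> k" using onto \<phi> by blast
    from bchoice[OF this] obtain y where y: "\<And>k. k < n \<Longrightarrow> y k \<in> carrier Q \<and> \<theta> (y k) = \<phi> k" by blast
    let ?t = "\<lambda>k. tens R Q P (y k) (x k)"
    have t: "?t \<in> {..<n} \<rightarrow> carrier (tensor_group R Q P)" using x y by auto
    have "\<epsilon> (finprod (tensor_group R Q P) ?t {..<n}) = finprod (add_monoid R) (\<lambda>k. \<epsilon> (?t k)) {..<n}"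
      by (rule hom_finprod[OF TQP.comm_monoid_axioms R.add.comm_monoid_axioms \<epsilon>h])
        (use t hom_one[OF \<epsilon>h TQP.is_group R.add.is_group] in auto)
    also have "\<dots> = finprod (add_monoid R) (\<lambda>k. \<phi> k (x k)) {..<n}"
    proof (rule comm_monoid.finprod_cong'[OF R.add.comm_monoid_axioms])
      fix k assume "k \<in> {..<n}"
      then show "\<epsilon> (?t k) = \<phi> k (x k)" using x y \<epsilon>\<theta> by simp
    next
      show "(\<lambda>k. \<phi> k (x k)) \<in> {..<n} \<rightarrow> carrier (add_monoid R)"
        using x \<phi> by (fastforce simp: right_hom_def hom_def)
    qed simp
    finally have "\<one>\<^bsub>R\<^esub> = \<epsilon> (finprod (tensor_group R Q P) ?t {..<n})"
      using one by simp
    then show ?thesis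
      using TQP.finprod_closed[OF t] by (intro image_eqI) simp_all
  qed
  show "\<one>\<^bsub>R\<^esub> \<in> \<gamma> ` carrier (tensor R P Q)"
  proof -
    obtain J :: "'p set" and x \<phi> where J: "finite J" and x: "\<And>j. j \<in> J \<Longrightarrow> x j \<in> carrier P"
      and \<phi>: "\<And>j. j \<in> J \<Longrightarrow> \<phi> j \<in> right_hom R P (regular_bimod R)"
      and basis: "\<And>p. p \<in> carrier P \<Longrightarrow> p = finprod P (\<lambda>j. ract P (x j) (\<phi> j p)) J"
    proof (rule right_dual_basis[OF mods(2) progen(1,2)], goal_cases)
      case (1 J x \<phi>)
      show ?case by (rule 1(1)[OF 1(2-5)])
    qed
    have "\<forall>j\<in>J. \<exists>q. q \<in> carrier Q \<and> \<theta> q = \<phi> j" using onto \<phi> by blast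
    from bchoice[OF this] obtain y where y: "\<And>j. j \<in> J \<Longrightarrow> y j \<in> carrier Q \<and> \<theta> (y j) = \<phi> j" by blast
    let ?t = "\<lambda>j. tens R P Q (x j) (y j)"
    have t: "?t \<in> J \<rightarrow> carrier (tensor_group R P Q)" using x y by auto
    let ?g = "\<gamma> (finprod (tensor_group R P Q) ?t J)"
    have gt: "\<gamma> (?t j) \<in> carrier R" if "j \<in> J" for j
      using hom_in_carrier[OF \<gamma>h, of "?t j"] t that by auto
    have g: "?g = finprod (add_monoid R) (\<lambda>j. \<gamma> (?t j)) J"
      by (rule hom_finprod[OF TPQ.comm_monoid_axioms R.add.comm_monoid_axioms \<gamma>h])
        (use t hom_one[OF \<gamma>h TPQ.is_group R.add.is_group] in auto)
    have gc: "?g \<in> carrier R" using hom_in_carrier[OF \<gamma>h TPQ.finprod_closed[OF t]] by simp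
    \<comment> \<open>By the coevaluation formula \<open>?g\<close> acts on P as the sum of the maps
      x j \<phi> j(-), which is the identity for a dual basis.\<close>
    have "lact P ?g p = p" if p: "p \<in> carrier P" for p
    proof -
      have h: "(\<lambda>r. lact P r p) \<in> hom (add_monoid R) P"
        using mods(1) p by (auto simp: left_module_def hom_def)
      have "lact P ?g p = finprod P (\<lambda>j. lact P (\<gamma> (?t j)) p) J"
        unfolding g
        by (rule hom_finprod[OF R.add.comm_monoid_axioms P.comm_monoid_axioms h])
          (use gt hom_one[OF h R.add.is_group P.is_group] in auto)
      also have "\<dots> = finprod P (\<lambda>j. ract P (x j) (\<phi> j p)) J"
      proof (rule P.finprod_cong')
        have eq: "lact P (\<gamma> (?t j)) p = ract P (x j) (\<phi> j p)" if "j \<in> J" for j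
          using fun_cong[OF \<gamma>\<theta>[of "x j" "y j"], of p] x y that p by simp
        then show "lact P (\<gamma> (?t j)) p = ract P (x j) (\<phi> j p)" if "j \<in> J" for j
          using that .
        have "lact P (\<gamma> (?t j)) p \<in> carrier P" if "j \<in> J" for j
          using mods(1) gt[OF that] p by (simp add: left_module_def)
        then show "(\<lambda>j. ract P (x j) (\<phi> j p)) \<in> J \<rightarrow> carrier P"
          by (intro Pi_I) (simp only: eq[symmetric])
      qed simp
      finally show ?thesis using basis[OF p] by simp
    qed
    then have "(\<lambda>p\<in>carrier P. lact P ?g p) = (\<lambda>p\<in>carrier P. lact P \<one>\<^bsub>R\<^esub> p)"
      using mods(1) by (auto simp: left_module_def fun_eq_iff)
    \<comment> \<open>The identification of R with \<open>right_End R P\<close> makes the left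
      action faithful, so an element acting as the identity is 1.\<close>
    then have "\<one>\<^bsub>R\<^esub> = ?g"
      using iso gc by (auto simp: ring_iso_def bij_betw_def dest: inj_onD)
    then show ?thesis
      using TPQ.finprod_closed[OF t] by (intro image_eqI) simp_all
  qed
qed

subsection \<open>Frobenius extensions\<close>

context ring_extension
begin

text \<open>
  The Frobenius homomorphism \<open>F\<close> is the image of \<open>1\<close> under \<open>A \<cong> Hom(A\<^sub>B, B\<^sub>B)\<close>, and the \<open>y j\<close> are
  the preimages of the coordinate functionals of a dual basis \<open>x j\<close> of \<open>A\<^sub>B\<close>.
\<close>

lemma frobenius_system:
  assumes "frobenius_extension B A h"
  obtains F and J :: "'a set" and x y where "F \<in> carrier H" "finite J"
    "\<And>j. j \<in> J \<Longrightarrow> x j \<in> carrier A" "\<And>j. j \<in> J \<Longrightarrow> y j \<in> carrier A"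
    "\<And>a. a \<in> carrier A \<Longrightarrow> a = finprod (add_monoid A) (\<lambda>j. x j \<otimes>\<^bsub>A\<^esub> h (F (y j \<otimes>\<^bsub>A\<^esub> a))) J"
    "\<And>a. a \<in> carrier A \<Longrightarrow> a = finprod (add_monoid A) (\<lambda>j. h (F (a \<otimes>\<^bsub>A\<^esub> x j)) \<otimes>\<^bsub>A\<^esub> y j) J"
proof -
  have mod: "right_module B L"
    by (simp add: right_module_def B.ring_axioms ring_bimod_group A.l_distr A.r_distr A.m_assoc)
  obtain J :: "'a set" and x \<phi> where J: "finite J" and x': "\<And>j. j \<in> J \<Longrightarrow> x j \<in> carrier L"
    and \<phi>: "\<And>j. j \<in> J \<Longrightarrow> \<phi> j \<in> right_hom B L (regular_bimod B)"
    and basis': "\<And>p. p \<in> carrier L \<Longrightarrow> p = finprod L (\<lambda>j. ract L (x j) (\<phi> j p)) J"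
  proof (rule right_dual_basis[OF mod], goal_cases)
    case (3 J x \<phi>)
    show ?case by (rule 3(1)[OF 3(2-5)])
  qed (use assms in \<open>simp_all add: frobenius_extension_def\<close>)
  have x: "x j \<in> carrier A" if "j \<in> J" for j using x'[OF that] by simp
  have \<phi>c: "\<phi> j a \<in> carrier B" if "j \<in> J" "a \<in> carrier A" for j a
    using \<phi>[OF that(1)] that(2) by (auto simp: right_hom_def hom_def)
  have basis: "a = finprod (add_monoid A) (\<lambda>j. x j \<otimes>\<^bsub>A\<^esub> h (\<phi> j a)) J" if a: "a \<in> carrier A" for a
  proof -
    have "finprod L (\<lambda>j. ract L (x j) (\<phi> j a)) J
        = finprod (add_monoid A) (\<lambda>j. ract L (x j) (\<phi> j a)) J"
      by (rule hom_finprod[where f = "\<lambda>x. x"])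
        (use x \<phi>c a in \<open>auto simp: hom_def A.add.comm_monoid_axioms
          comm_group.axioms(1)[OF ring_bimod_group]\<close>)
    then show ?thesis using basis'[of a] a by simp
  qed
  obtain \<theta> where \<theta>: "\<theta> \<in> bimod_iso B A N (right_dual B L)"
    using assms by (auto simp: frobenius_extension_def)
  define F where "F = \<theta> \<one>\<^bsub>A\<^esub>"
  have \<theta>c: "\<theta> a \<in> right_hom B L (regular_bimod B)" if "a \<in> carrier A" for a
    using \<theta> that by (auto simp: bimod_iso_def right_dual_def bij_betw_def)
  have inj: "inj_on \<theta> (carrier A)" and onto: "\<theta> ` carrier A = right_hom B L (regular_bimod B)"
    using \<theta> by (simp_all add: bimod_iso_def right_dual_def bij_betw_def)
  \<comment> \<open>Right \<open>A\<close>-linearity at 1: \<theta> a = \<theta>(1) a, and in the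
    dual this is F(a -).\<close>
  have \<theta>F: "\<theta> a = (\<lambda>p\<in>carrier A. F (a \<otimes>\<^bsub>A\<^esub> p))" if a: "a \<in> carrier A" for a
  proof -
    have "\<theta> (c \<otimes>\<^bsub>A\<^esub> a) = ract (right_dual B L) (\<theta> c) a" if "c \<in> carrier A" for c
      using \<theta> a that by (simp add: bimod_iso_def bimod_hom_def right_hom_def)
    from this[of "\<one>\<^bsub>A\<^esub>"] show ?thesis using a by (simp add: F_def right_dual_def)
  qed
  have F: "F \<in> carrier H"
    unfolding hat_iff
  proof (intro conjI ballI)
    have F': "F \<in> right_hom B L (regular_bimod B)" unfolding F_def by (rule \<theta>c) simp
    then show "F \<in> carrier A \<rightarrow>\<^sub>E carrier B"
      by (auto simp: right_hom_def hom_def PiE_def)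
    show "F (a \<oplus>\<^bsub>A\<^esub> c) = F a \<oplus>\<^bsub>B\<^esub> F c" if "a \<in> carrier A" "c \<in> carrier A" for a c
      using F' that by (auto simp: right_hom_def hom_def)
    show "F (a \<otimes>\<^bsub>A\<^esub> h b) = F a \<otimes>\<^bsub>B\<^esub> b" if "a \<in> carrier A" "b \<in> carrier B" for a b
      using F' that by (auto simp: right_hom_def)
    \<comment> \<open>Unlike right linearity, this is not part of membership in the dual. It comes
      from two expressions for \<theta>(h b): b F(-) by left linearity of \<theta>, and F(h b -) by
      \<open>\<theta>F\<close>.\<close>
    show "F (h b \<otimes>\<^bsub>A\<^esub> a) = b \<otimes>\<^bsub>B\<^esub> F a" if a: "a \<in> carrier A" and b: "b \<in> carrier B" for a b
    proof -
      have "\<theta> (h b \<otimes>\<^bsub>A\<^esub> c) = lact (right_dual B L) b (\<theta> c)" if "c \<in> carrier A" for c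
        using \<theta> b that by (simp add: bimod_iso_def bimod_hom_def left_hom_def)
      from this[of "\<one>\<^bsub>A\<^esub>"] have "\<theta> (h b) = (\<lambda>p\<in>carrier A. b \<otimes>\<^bsub>B\<^esub> F p)"
        using b by (simp add: right_dual_def F_def)
      then show ?thesis
        using fun_cong[OF \<theta>F[of "h b"], of a] a b by simp
    qed
  qed
  have F_hom: "F \<in> hom (add_monoid A) (add_monoid B)"
    using hatD(1,2)[OF F] by (auto simp: hom_def)
  have F0: "F \<zero>\<^bsub>A\<^esub> = \<zero>\<^bsub>B\<^esub>"
    using hom_one[OF F_hom] A.add.is_group B.add.is_group by simp
  have "\<forall>j\<in>J. \<exists>y. y \<in> carrier A \<and> \<theta> y = \<phi> j"
    using onto \<phi> by (metis imageE)
  from bchoice[OF this] obtain y where y': "\<forall>j\<in>J. y j \<in> carrier A \<and> \<theta> (y j) = \<phi> j" by blast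
  have y: "y j \<in> carrier A" if "j \<in> J" for j using y' that by blast
  have \<phi>F: "\<phi> j a = F (y j \<otimes>\<^bsub>A\<^esub> a)" if "j \<in> J" "a \<in> carrier A" for j a
    using y' \<theta>F[of "y j"] that by auto
  have basis1: "a = finprod (add_monoid A) (\<lambda>j. x j \<otimes>\<^bsub>A\<^esub> h (F (y j \<otimes>\<^bsub>A\<^esub> a))) J"
    if a: "a \<in> carrier A" for a
  proof -
    have "finprod (add_monoid A) (\<lambda>j. x j \<otimes>\<^bsub>A\<^esub> h (\<phi> j a)) J
      = finprod (add_monoid A) (\<lambda>j. x j \<otimes>\<^bsub>A\<^esub> h (F (y j \<otimes>\<^bsub>A\<^esub> a))) J"
      by (rule comm_monoid.finprod_cong'[OF A.add.comm_monoid_axioms])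
        (use a x y \<phi>F hatD(1)[OF F] in auto)
    then show ?thesis using basis[OF a] by simp
  qed
  \<comment> \<open>The equality is tested after the injective \<theta>, that is, by applying F to
    products with every w. The sum then becomes \<Sum> F(a x j) F(y j w) = F(a \<Sum> x j F(y j w)),
    and the first expansion of w makes this F(a w).\<close>
  have basis2: "a = finprod (add_monoid A) (\<lambda>j. h (F (a \<otimes>\<^bsub>A\<^esub> x j)) \<otimes>\<^bsub>A\<^esub> y j) J"
    if a: "a \<in> carrier A" for a
  proof (rule inj_onD[OF inj])
    let ?s = "\<lambda>j. h (F (a \<otimes>\<^bsub>A\<^esub> x j)) \<otimes>\<^bsub>A\<^esub> y j"
    have s: "?s j \<in> carrier A" if "j \<in> J" for j using a x[OF that] y[OF that] hatD(1)[OF F] by simp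
    show sc: "finprod (add_monoid A) ?s J \<in> carrier A"
      using comm_monoid.finprod_closed[OF A.add.comm_monoid_axioms, of ?s J] s by auto
    have "F (finprod (add_monoid A) ?s J \<otimes>\<^bsub>A\<^esub> w) = F (a \<otimes>\<^bsub>A\<^esub> w)" if w: "w \<in> carrier A" for w
    proof -
      have h1: "(\<lambda>z. F (z \<otimes>\<^bsub>A\<^esub> w)) \<in> hom (add_monoid A) (add_monoid B)"
        and h2: "(\<lambda>z. F (a \<otimes>\<^bsub>A\<^esub> z)) \<in> hom (add_monoid A) (add_monoid B)"
        using w a hatD(1,2)[OF F] by (auto simp: hom_def A.l_distr A.r_distr)
      have "F (finprod (add_monoid A) ?s J \<otimes>\<^bsub>A\<^esub> w) = finprod (add_monoid B) (\<lambda>j. F (?s j \<otimes>\<^bsub>A\<^esub> w)) J"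
        by (rule hom_finprod[OF A.add.comm_monoid_axioms B.add.comm_monoid_axioms h1])
          (use s w F0 in auto)
      also have "\<dots> = finprod (add_monoid B) (\<lambda>j. F (a \<otimes>\<^bsub>A\<^esub> (x j \<otimes>\<^bsub>A\<^esub> h (F (y j \<otimes>\<^bsub>A\<^esub> w))))) J"
      proof (rule comm_monoid.finprod_cong'[OF B.add.comm_monoid_axioms])
        fix j assume j: "j \<in> J"
        have "F (?s j \<otimes>\<^bsub>A\<^esub> w) = F (a \<otimes>\<^bsub>A\<^esub> x j) \<otimes>\<^bsub>B\<^esub> F (y j \<otimes>\<^bsub>A\<^esub> w)"
          using a w x[OF j] y[OF j] by (simp add: A.m_assoc hatD[OF F])
        also have "\<dots> = F ((a \<otimes>\<^bsub>A\<^esub> x j) \<otimes>\<^bsub>A\<^esub> h (F (y j \<otimes>\<^bsub>A\<^esub> w)))"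
          using a w x[OF j] y[OF j] by (simp add: hatD[OF F])
        finally show "F (?s j \<otimes>\<^bsub>A\<^esub> w) = F (a \<otimes>\<^bsub>A\<^esub> (x j \<otimes>\<^bsub>A\<^esub> h (F (y j \<otimes>\<^bsub>A\<^esub> w))))"
          using a w x[OF j] y[OF j] by (simp add: A.m_assoc hatD[OF F])
      qed (use a w x y hatD(1)[OF F] in auto)
      also have "\<dots> = F (a \<otimes>\<^bsub>A\<^esub> finprod (add_monoid A) (\<lambda>j. x j \<otimes>\<^bsub>A\<^esub> h (F (y j \<otimes>\<^bsub>A\<^esub> w))) J)"
        by (rule hom_finprod[OF A.add.comm_monoid_axioms B.add.comm_monoid_axioms h2, symmetric])
          (use a w x y hatD(1)[OF F] F0 in auto)
      finally show ?thesis using basis1[OF w] by simp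
    qed
    then show "\<theta> a = \<theta> (finprod (add_monoid A) ?s J)"
      using \<theta>F[OF a] \<theta>F[OF sc] by (auto simp: fun_eq_iff)
  qed (rule a)
  show ?thesis
    by (rule that[OF F J x y basis1 basis2])
qed

text \<open>The Casimir condition holds because the two expansions describe multiplication by a
  through the same matrix. The two pairings with F are the two expansions of 1.\<close>

lemma frobenius_one:
  assumes "frobenius_extension B A h"
  shows "\<exists>F\<in>carrier H. \<exists>e\<in>carrier C. psi F e = \<one>\<^bsub>A\<^esub> \<and> phi F e = \<one>\<^bsub>A\<^esub>"
proof -
  obtain F and J :: "'a set" and x y where F: "F \<in> carrier H" and J: "finite J"
    and x: "\<And>j. j \<in> J \<Longrightarrow> x j \<in> carrier A" and y: "\<And>j. j \<in> J \<Longrightarrow> y j \<in> carrier A"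
    and b1: "\<And>a. a \<in> carrier A \<Longrightarrow> a = finprod (add_monoid A) (\<lambda>j. x j \<otimes>\<^bsub>A\<^esub> h (F (y j \<otimes>\<^bsub>A\<^esub> a))) J"
    and b2: "\<And>a. a \<in> carrier A \<Longrightarrow> a = finprod (add_monoid A) (\<lambda>j. h (F (a \<otimes>\<^bsub>A\<^esub> x j)) \<otimes>\<^bsub>A\<^esub> y j) J"
  proof (rule frobenius_system[OF assms], goal_cases)
    case (1 F J x y)
    show ?case by (rule 1(1)[OF 1(2-7)])
  qed
  have FB: "F a \<in> carrier B" if "a \<in> carrier A" for a using hatD(1)[OF F that] .
  define e where "e = finprod T (\<lambda>j. x j \<otimes>\<^sub>B y j) J"
  have t: "(\<lambda>j. x j \<otimes>\<^sub>B y j) \<in> J \<rightarrow> carrier T" using x y by auto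
  have eT: "e \<in> carrier T" unfolding e_def using t by (rule T.finprod_closed)
  note Tm = T.comm_monoid_axioms and Am = A.add.comm_monoid_axioms
  have "outl a e = outr a e" if a: "a \<in> carrier A" for a
  proof -
    \<comment> \<open>F(y j a x i) is at once the right coefficient of a x i at x j and the left
      coefficient of y j a at y i. Hence a e and e a are the same double sum, after moving the
      scalars across the tensor sign and exchanging the summations.\<close>
    let ?b = "\<lambda>i j. F (y j \<otimes>\<^bsub>A\<^esub> (a \<otimes>\<^bsub>A\<^esub> x i))"
    have b: "?b i j \<in> carrier B" if "i \<in> J" "j \<in> J" for i j using a x y that FB by simp
    have "outl a e = finprod T (\<lambda>i. outl a (x i \<otimes>\<^sub>B y i)) J"
      unfolding e_def by (rule hom_finprod[OF Tm Tm outl_hom[OF a] _ t]) (simp add: a)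
    also have "\<dots> = finprod T (\<lambda>i. finprod T (\<lambda>j. x j \<otimes>\<^sub>B (h (?b i j) \<otimes>\<^bsub>A\<^esub> y i)) J) J"
    proof (rule T.finprod_cong')
      fix i assume i: "i \<in> J"
      have "outl a (x i \<otimes>\<^sub>B y i) = (a \<otimes>\<^bsub>A\<^esub> x i) \<otimes>\<^sub>B y i" using a x[OF i] y[OF i] by simp
      also have "\<dots> = finprod (add_monoid A) (\<lambda>j. x j \<otimes>\<^bsub>A\<^esub> h (?b i j)) J \<otimes>\<^sub>B y i"
        using b1[of "a \<otimes>\<^bsub>A\<^esub> x i"] a x[OF i] by simp
      also have "\<dots> = finprod T (\<lambda>j. (x j \<otimes>\<^bsub>A\<^esub> h (?b i j)) \<otimes>\<^sub>B y i) J"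
      proof (rule hom_finprod[OF Am Tm])
        show hl: "(\<lambda>m. m \<otimes>\<^sub>B y i) \<in> hom (add_monoid A) T"
          using AA.tens_hom_left[of "y i"] y[OF i] by (simp add: hom_def)
        show "\<one>\<^bsub>add_monoid A\<^esub> \<otimes>\<^sub>B y i = \<one>\<^bsub>T\<^esub>"
          using hom_one[OF hl A.add.is_group T.is_group] by simp
        show "(\<lambda>j. x j \<otimes>\<^bsub>A\<^esub> h (?b i j)) \<in> J \<rightarrow> carrier (add_monoid A)"
          using x b[OF i] by simp
      qed
      also have "\<dots> = finprod T (\<lambda>j. x j \<otimes>\<^sub>B (h (?b i j) \<otimes>\<^bsub>A\<^esub> y i)) J"
      proof (rule T.finprod_cong')
        fix j assume j: "j \<in> J"
        show "(x j \<otimes>\<^bsub>A\<^esub> h (?b i j)) \<otimes>\<^sub>B y i = x j \<otimes>\<^sub>B (h (?b i j) \<otimes>\<^bsub>A\<^esub> y i)"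
          using AA.tens_balance[of "x j" "?b i j" "y i"] x[OF j] y[OF i] b[OF i j] by simp
      qed (use x y[OF i] b[OF i] in auto)
      finally show "outl a (x i \<otimes>\<^sub>B y i) = finprod T (\<lambda>j. x j \<otimes>\<^sub>B (h (?b i j) \<otimes>\<^bsub>A\<^esub> y i)) J" .
    qed (use x y b in auto)
    also have "\<dots> = finprod T (\<lambda>j. finprod T (\<lambda>i. x j \<otimes>\<^sub>B (h (?b i j) \<otimes>\<^bsub>A\<^esub> y i)) J) J"
      by (rule T.finprod_swap) (use x y b J in auto)
    also have "\<dots> = finprod T (\<lambda>j. outr a (x j \<otimes>\<^sub>B y j)) J"
    proof (rule T.finprod_cong')
      fix j assume j: "j \<in> J"
      have "outr a (x j \<otimes>\<^sub>B y j) = x j \<otimes>\<^sub>B (y j \<otimes>\<^bsub>A\<^esub> a)" using a x[OF j] y[OF j] by simp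
      also have "\<dots> = x j \<otimes>\<^sub>B finprod (add_monoid A) (\<lambda>i. h (F (y j \<otimes>\<^bsub>A\<^esub> a \<otimes>\<^bsub>A\<^esub> x i)) \<otimes>\<^bsub>A\<^esub> y i) J"
        using b2[of "y j \<otimes>\<^bsub>A\<^esub> a"] a y[OF j] by simp
      also have "\<dots> = finprod T (\<lambda>i. x j \<otimes>\<^sub>B (h (F (y j \<otimes>\<^bsub>A\<^esub> a \<otimes>\<^bsub>A\<^esub> x i)) \<otimes>\<^bsub>A\<^esub> y i)) J"
      proof (rule hom_finprod[OF Am Tm])
        show hr: "(\<lambda>n. x j \<otimes>\<^sub>B n) \<in> hom (add_monoid A) T"
          using AA.tens_hom_right[of "x j"] x[OF j] by (simp add: hom_def)
        show "x j \<otimes>\<^sub>B \<one>\<^bsub>add_monoid A\<^esub> = \<one>\<^bsub>T\<^esub>"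
          using hom_one[OF hr A.add.is_group T.is_group] by simp
        show "(\<lambda>i. h (F (y j \<otimes>\<^bsub>A\<^esub> a \<otimes>\<^bsub>A\<^esub> x i)) \<otimes>\<^bsub>A\<^esub> y i) \<in> J \<rightarrow> carrier (add_monoid A)"
          using a x y y[OF j] FB by simp
      qed
      also have "\<dots> = finprod T (\<lambda>i. x j \<otimes>\<^sub>B (h (?b i j) \<otimes>\<^bsub>A\<^esub> y i)) J"
        by (rule T.finprod_cong') (use a x y y[OF j] x[OF j] FB in \<open>auto simp: A.m_assoc\<close>)
      finally show "finprod T (\<lambda>i. x j \<otimes>\<^sub>B (h (?b i j) \<otimes>\<^bsub>A\<^esub> y i)) J = outr a (x j \<otimes>\<^sub>B y j)" by simp
    qed (use a x y in auto)
    also have "\<dots> = outr a e"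
      unfolding e_def by (rule hom_finprod[OF Tm Tm outr_hom[OF a] _ t, symmetric]) (simp add: a)
    finally show ?thesis .
  qed
  then have e: "e \<in> carrier C" using eT by simp
  have "psi F e = finprod (add_monoid A) (\<lambda>j. psi F (x j \<otimes>\<^sub>B y j)) J"
    unfolding e_def by (rule hom_finprod[OF Tm Am psi_hom[OF F] _ t]) (simp add: F)
  also have "\<dots> = finprod (add_monoid A) (\<lambda>j. x j \<otimes>\<^bsub>A\<^esub> h (F (y j \<otimes>\<^bsub>A\<^esub> \<one>\<^bsub>A\<^esub>))) J"
    by (rule comm_monoid.finprod_cong'[OF Am]) (use F x y FB in auto)
  also have "\<dots> = \<one>\<^bsub>A\<^esub>" using b1[of "\<one>\<^bsub>A\<^esub>"] by simp
  finally have 1: "psi F e = \<one>\<^bsub>A\<^esub>" .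
  have "phi F e = finprod (add_monoid A) (\<lambda>j. phi F (x j \<otimes>\<^sub>B y j)) J"
    unfolding e_def by (rule hom_finprod[OF Tm Am phi_hom[OF F] _ t]) (simp add: F)
  also have "\<dots> = finprod (add_monoid A) (\<lambda>j. h (F (\<one>\<^bsub>A\<^esub> \<otimes>\<^bsub>A\<^esub> x j)) \<otimes>\<^bsub>A\<^esub> y j) J"
    by (rule comm_monoid.finprod_cong'[OF Am]) (use F x y FB in auto)
  also have "\<dots> = \<one>\<^bsub>A\<^esub>" using b2[of "\<one>\<^bsub>A\<^esub>"] by simp
  finally have "phi F e = \<one>\<^bsub>A\<^esub>" .
  with 1 F e show ?thesis by blast
qed

lemma surjective_from_one:
  assumes "\<one>\<^bsub>A\<^esub> \<in> Phi B A h ` carrier (tensor R C H)" "\<one>\<^bsub>A\<^esub> \<in> Psi B A h ` carrier (tensor R H C)"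
  shows "Phi B A h ` carrier (tensor R C H) = carrier R \<and> Psi B A h ` carrier (tensor R H C) = carrier R"
  using tensor_image_onto[OF casimir_bimodule hat_bimodule Phi_bimod_hom]
    tensor_image_onto[OF hat_bimodule casimir_bimodule Psi_bimod_hom] assms
  unfolding centralizer_sel by blast

lemma frobenius_surjective:
  assumes "frobenius_extension B A h"
  shows "Phi B A h ` carrier (tensor R C H) = carrier R \<and> Psi B A h ` carrier (tensor R H C) = carrier R"
proof -
  obtain F e where F: "F \<in> carrier H" and e: "e \<in> carrier C"
    and one: "psi F e = \<one>\<^bsub>A\<^esub>" "phi F e = \<one>\<^bsub>A\<^esub>"
    using frobenius_one[OF assms] by blast
  show ?thesis
  proof (rule surjective_from_one)
    show "\<one>\<^bsub>A\<^esub> \<in> Phi B A h ` carrier (tensor R C H)"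
      using Phi_tens[OF F e] one CH.tens_closed[OF e F] by (intro image_eqI[of _ _ "tens R C H e F"]) simp_all
    show "\<one>\<^bsub>A\<^esub> \<in> Psi B A h ` carrier (tensor R H C)"
      using Psi_tens[OF F e] one HC.tens_closed[OF F e] by (intro image_eqI[of _ _ "tens R H C F e"]) simp_all
  qed
qed

lemma simple_surjective:
  assumes "simple_ring R"
    and "(\<exists>t\<in>carrier (tensor R C H). Phi B A h t \<noteq> \<zero>\<^bsub>A\<^esub>) \<or> (\<exists>t\<in>carrier (tensor R H C). Psi B A h t \<noteq> \<zero>\<^bsub>A\<^esub>)"
  shows "Phi B A h ` carrier (tensor R C H) = carrier R \<and> Psi B A h ` carrier (tensor R H C) = carrier R"
  using morita_context_simple[OF morita_context_extension assms(1)]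
    morita_context_simple[OF morita_context_swap[OF morita_context_extension] assms(1)] assms(2)
  unfolding centralizer_sel by blast

lemma dual_pair_surjective:
  assumes "morita_dual_pair R C H (Psi B A h) (Phi B A h) \<or> morita_dual_pair R H C (Phi B A h) (Psi B A h)"
  shows "Phi B A h ` carrier (tensor R C H) = carrier R \<and> Psi B A h ` carrier (tensor R H C) = carrier R"
  using assms morita_dual_pair_one[OF casimir_bimodule hat_bimodule Psi_bimod_hom Phi_bimod_hom]
    morita_dual_pair_one[OF hat_bimodule casimir_bimodule Phi_bimod_hom Psi_bimod_hom] surjective_from_one
  unfolding centralizer_sel by blast

end

theorem theorem5p3:
  fixes A :: "'a ring" and B :: "'b ring" and h :: "'b \<Rightarrow> 'a"
  assumes "ring_hom_ring B A h"
  shows "morita_context (centralizer B A h) (centralizer B A h) (hat B A h) (casimir B A h)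
           (Phi B A h) (Psi B A h) \<and>
    (frobenius_extension B A h \<or>
     (simple_ring (centralizer B A h) \<and>
        ((\<exists>t\<in>carrier (tensor (centralizer B A h) (casimir B A h) (hat B A h)).
            Phi B A h t \<noteq> \<zero>\<^bsub>A\<^esub>) \<or>
         (\<exists>t\<in>carrier (tensor (centralizer B A h) (hat B A h) (casimir B A h)).
            Psi B A h t \<noteq> \<zero>\<^bsub>A\<^esub>))) \<or>
     (morita_dual_pair (centralizer B A h) (casimir B A h) (hat B A h) (Psi B A h) (Phi B A h) \<or>
      morita_dual_pair (centralizer B A h) (hat B A h) (casimir B A h) (Phi B A h) (Psi B A h))
     \<longrightarrow>
     Phi B A h ` carrier (tensor (centralizer B A h) (casimir B A h) (hat B A h))
       = carrier (centralizer B A h) \<and>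
     Psi B A h ` carrier (tensor (centralizer B A h) (hat B A h) (casimir B A h))
       = carrier (centralizer B A h))"
proof -
  interpret ring_extension A B h
    using assms by (rule ring_extension.intro)
  show ?thesis
    using morita_context_extension frobenius_surjective simple_surjective dual_pair_surjective
    by blast
qed

end
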